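(* Let $G:I\to I$ be the Gauss map on $I=[0,1]$. The weak$^*$ closure $\overline{\mathcal{M}(I,G)}$ (in the space of Borel probability measures on $I$) of the set of $G$-invariant Borel probability measures is equal to the convex hull of the union of $\mathcal{M}_{\mathrm{irr}}(I,G)$ and the set of finite-continued-fraction measures.
   Context: $I=[0,1]$; the Gauss map $G:I\to I$ is $G(x)=\frac1x-\lfloor\frac1x\rfloor$ for $x\in(0,1]$ and $G(0)=0$. $\mathcal{M}(I,G)$ is the set of $G$-invariant Borel probability measures on $I$. $\mathcal{M}_{\mathrm{irr}}(I,G)$ is the set of $\mu\in\mathcal{M}(I,G)$ with $\mu(I\cap\mathbb{Q})=0$. $\mathbb{N}=\{1,2,\dots\}$ and $\delta_x$ is the Dirac measure at $x$. For $a_1,\dots,a_n\in\mathbb{N}$, $[a_1,\dots,a_n]=\cfrac{1}{a_1+\cfrac{1}{\cdots+\cfrac{1}{a_n}}}$. For $n\in\mathbb{N}$ and $\mathbf{a}=(a_1,\dots,a_n)\in\mathbb{N}^n$ put $p_0(\mathbf{a})=0$ and $p_k(\mathbf{a})=[a_{n-k+1},\dots,a_n]$ for $1\le k\le n$. The finite-continued-fraction (FCF) measure associated with $\mathbf{a}$ is $\mu_{\mathbf{a}}=\frac{1}{n+1}\sum_{k=0}^n\delta_{p_k(\mathbf{a})}$ (the case $a_n=1$ is allowed).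
   Formalization: "Convex hull" is taken with countable convex combinations, and n = 0 is allowed for FCF measures (giving the Dirac measure at 0); with finite combinations and n ≥ 1 the equality fails, e.g. for δ_0 and for the sum of 2^{-i} μ_{(i)}. *)

theory Defs
  imports "HOL-Probability.Probability"
begin

abbreviation unit_borel :: "real measure" where
  "unit_borel \<equiv> restrict_space borel {0..1}"

definition prob_measures :: "real measure set" where
  "prob_measures = {\<mu>. prob_space \<mu> \<and> sets \<mu> = sets unit_borel}"

text \<open>The coarsest topology on \<^const>\<open>prob_measures\<close> making all maps
  \<open>\<mu> \<mapsto> \<integral>f d\<mu>\<close>, with \<open>f\<close> continuous on \<open>[0,1]\<close>, continuous. The integral
  only sees the values of \<open>f\<close> on \<open>space \<mu> = [0,1]\<close>.\<close>

definition weak_star_topology :: "real measure topology" where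
  "weak_star_topology = topology_generated_by
     {{\<mu> \<in> prob_measures. (\<integral>x. f x \<partial>\<mu>) \<in> U} | f U. continuous_on {0..1} f \<and> open (U :: real set)}"

lemma topspace_weak_star_topology: "topspace weak_star_topology = prob_measures"
proof -
  have "prob_measures \<in> {{\<mu> \<in> prob_measures. (\<integral>x. f x \<partial>\<mu>) \<in> U} | f U.
      continuous_on {0..1} f \<and> open (U :: real set)}"
    by (auto intro!: exI[of _ "\<lambda>_. 0"] exI[of _ UNIV])
  then show ?thesis
    unfolding weak_star_topology_def topology_generated_by_topspace by auto
qed

definition gauss_map :: "real \<Rightarrow> real" where
  "gauss_map x = (if x = 0 then 0 else 1 / x - of_int \<lfloor>1 / x\<rfloor>)"

lemma gauss_map_measurable: "gauss_map \<in> measurable unit_borel unit_borel"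
proof (rule measurable_restrict_space2)
  show "gauss_map \<in> space unit_borel \<rightarrow> {0..1}"
    by (auto simp: gauss_map_def) linarith+
  have "gauss_map \<in> borel_measurable borel"
    unfolding gauss_map_def by measurable
  then show "gauss_map \<in> borel_measurable unit_borel"
    by (rule measurable_restrict_space1)
qed

definition invariant_measures :: "real measure set" where
  "invariant_measures = {\<mu> \<in> prob_measures. distr \<mu> unit_borel gauss_map = \<mu>}"

definition irrational_invariant_measures :: "real measure set" where
  "irrational_invariant_measures = {\<mu> \<in> invariant_measures. emeasure \<mu> ({0..1} \<inter> \<rat>) = 0}"

fun cont_frac :: "nat list \<Rightarrow> real" where
  "cont_frac [] = 0"
| "cont_frac (a # as) = 1 / (real a + cont_frac as)"

definition fcf_point :: "nat list \<Rightarrow> nat \<Rightarrow> real" where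
  "fcf_point as k = cont_frac (drop (length as - k) as)"

definition fcf_measure :: "nat list \<Rightarrow> real measure" where
  "fcf_measure as = measure_of {0..1} (sets unit_borel)
     (\<lambda>A. (\<Sum>k\<le>length as. emeasure (return unit_borel (fcf_point as k)) A) / ennreal (real (length as + 1)))"

text \<open>The list may be empty: for \<open>n = 0\<close> the defining average is the Dirac measure at \<open>0\<close>,
  which is itself invariant (\<open>0\<close> is a fixed point) but is not a convex combination of
  the averages with \<open>n \<ge> 1\<close> and of measures vanishing on the rationals.\<close>

definition fcf_measures :: "real measure set" where
  "fcf_measures = {fcf_measure as | as. \<forall>a\<in>set as. 1 \<le> a}"

text \<open>Convex combinations of measures may have countably many terms; finite ones are those
  with \<open>w i = 0\<close> for almost all \<open>i\<close>. A weak* closed convex set of probability measures is closed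
  under countable combinations, and finite ones do not suffice in the present setting, since
  they would only have finitely many rational atoms.\<close>

definition countable_convex_hull :: "real measure set \<Rightarrow> real measure set" where
  "countable_convex_hull S = {\<mu> \<in> prob_measures. \<exists>(w :: nat \<Rightarrow> real) \<nu>.
     (\<forall>i. 0 \<le> w i) \<and> w sums 1 \<and> (\<forall>i. \<nu> i \<in> S) \<and>
     (\<forall>A\<in>sets unit_borel. (\<lambda>i. w i * measure (\<nu> i) A) sums measure \<mu> A)}"

lemma cont_frac_range:
  assumes "\<forall>a\<in>set as. 1 \<le> a"
  shows "0 \<le> cont_frac as \<and> cont_frac as \<le> 1"
  using assms
proof (induction as)
  case (Cons a as)
  then have "0 \<le> cont_frac as" "1 \<le> real a" by auto
  then show ?case by (auto simp: divide_simps)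
qed simp

lemma fcf_point_in_unit:
  assumes "\<forall>a\<in>set as. 1 \<le> a"
  shows "fcf_point as k \<in> {0..1}"
  using cont_frac_range[of "drop (length as - k) as"] assms set_drop_subset
  unfolding fcf_point_def by fastforce

lemma space_fcf_measure: "space (fcf_measure as) = {0..1}"
  unfolding fcf_measure_def
  by (rule space_measure_of) (use sets.space_closed[of unit_borel] in \<open>auto simp: space_restrict_space\<close>)

lemma sets_fcf_measure: "sets (fcf_measure as) = sets unit_borel"
  unfolding fcf_measure_def
  using sets.sets_measure_of_eq[of unit_borel] by (simp add: space_restrict_space)

lemma emeasure_fcf_measure:
  assumes "A \<in> sets unit_borel"
  shows "emeasure (fcf_measure as) A =
    (\<Sum>k\<le>length as. emeasure (return unit_borel (fcf_point as k)) A) / ennreal (real (length as + 1))"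
proof (rule emeasure_measure_of[OF fcf_measure_def])
  show "sets unit_borel \<subseteq> Pow {0..1}"
    using sets.space_closed[of unit_borel] by (auto simp: space_restrict_space)
  show "A \<in> sets (fcf_measure as)"
    using assms by (simp add: sets_fcf_measure)
  show "positive (sets (fcf_measure as)) (\<lambda>A. (\<Sum>k\<le>length as.
      emeasure (return unit_borel (fcf_point as k)) A) / ennreal (real (length as + 1)))"
    by (simp add: positive_def)
  show "countably_additive (sets (fcf_measure as)) (\<lambda>A. (\<Sum>k\<le>length as.
      emeasure (return unit_borel (fcf_point as k)) A) / ennreal (real (length as + 1)))"
  proof (rule countably_additiveI)
    fix B :: "nat \<Rightarrow> real set"
    assume B: "range B \<subseteq> sets (fcf_measure as)" "disjoint_family B"
    have *: "(\<Sum>i. emeasure (return unit_borel x) (B i)) = emeasure (return unit_borel x) (\<Union>i. B i)" for x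
      by (rule suminf_emeasure) (use B sets_fcf_measure in auto)
    show "(\<Sum>i. (\<Sum>k\<le>length as. emeasure (return unit_borel (fcf_point as k)) (B i))
        / ennreal (real (length as + 1))) =
      (\<Sum>k\<le>length as. emeasure (return unit_borel (fcf_point as k)) (\<Union>i. B i))
        / ennreal (real (length as + 1))"
      unfolding ennreal_suminf_divide by (simp add: suminf_sum * del: emeasure_return)
  qed
qed

lemma fcf_measures_subset: "fcf_measures \<subseteq> prob_measures"
proof
  fix \<mu> assume "\<mu> \<in> fcf_measures"
  then obtain as where as: "\<mu> = fcf_measure as" "\<forall>a\<in>set as. 1 \<le> a"
    by (auto simp: fcf_measures_def)
  have "emeasure (return unit_borel (fcf_point as k)) {0..1} = 1" for k
    using fcf_point_in_unit[OF as(2)] by (simp add: sets_restrict_space_iff)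
  then have "emeasure (fcf_measure as) {0..1} =
      (\<Sum>k\<le>length as. 1) / ennreal (real (length as + 1))"
    by (subst emeasure_fcf_measure) (auto simp: sets_restrict_space_iff simp del: emeasure_return)
  also have "(\<Sum>k\<le>length as. 1 :: ennreal) = ennreal (real (length as + 1))"
    by (simp add: ennreal_of_nat_eq_real_of_nat del: of_nat_Suc)
  finally have "emeasure (fcf_measure as) (space (fcf_measure as)) = 1"
    by (simp add: space_fcf_measure ennreal_divide_self)
  then show "\<mu> \<in> prob_measures"
    using as by (auto simp: prob_measures_def sets_fcf_measure intro: prob_spaceI)
qed

lemma fcf_measure_Nil: "fcf_measure [] = return unit_borel 0"
  by (rule measure_eqI) (auto simp: sets_fcf_measure emeasure_fcf_measure fcf_point_def indicator_def divide_ennreal_def)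

end

theory Submission
  imports Defs
begin

text \<open>Let \<open>Y\<close> be the set of sequences \<open>y\<close> in \<open>[0,1]\<close> such that, for every \<open>i\<close>, either \<open>y i = 0\<close> or
  \<open>y i = 1 / (a + y (i + 1))\<close> with a positive integer \<open>a\<close>. It is compact and shift-invariant, contains all
  Gauss orbits, and after a zero it may continue arbitrarily. Hence a weak* limit of \<open>G\<close>-invariant measures
  lifts to a shift-invariant measure on \<open>Y\<close>, of which it is the image under \<open>y \<mapsto> y 0\<close>. The sequences
  without zeros are orbits of irrational points and give the irrational part. On the rest, recurrence
  to \<open>{y 0 = 0}\<close> cuts almost every sequence into excursions \<open>0, [a\<^sub>1,\<dots>,a\<^sub>n], [a\<^sub>2,\<dots>,a\<^sub>n], \<dots>, [a\<^sub>n], 0\<close>, and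
  by Kac's formula each word contributes a multiple of its FCF measure. Conversely, the FCF measure of
  \<open>(a\<^sub>1,\<dots>,a\<^sub>n)\<close> is the limit of the periodic orbits with period \<open>(a\<^sub>1,\<dots>,a\<^sub>n,N)\<close> as \<open>N \<rightarrow> \<infinity>\<close>.\<close>

subsection \<open>The closure and countable convex combinations\<close>

text \<open>The obstacle is that \<open>gauss_map\<close> jumps at 0 and at 1/a for a \<ge> 2, so a
  weak* limit of invariant measures need not be invariant. Replacing the map by the closure of its
  graph, \<open>gauss_rel\<close>, and points by sequences that follow this relation gives a
  continuous shift, whose invariance survives limits. The relation is ambiguous in two ways: 0 may
  be followed by anything, and 1/(a+1) by 0 (digit a+1) or by 1 (digit a). The second ambiguity is
  the source of words ending in 1. Compactness of measures on sequences comes from Helly selection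
  on the line: the digits, with 0 read as an infinite digit, code the orbit space as a compact set
  of reals. In Kac's formula the weight of a word of length n is n+1 times the mass of its
  excursion: for every j \<le> n the excursion has exactly one point that is j steps away from its
  final zero, and these points are the atoms of the FCF measure.\<close>

lemma weak_star_open_nbhd:
  assumes "openin weak_star_topology U" "\<mu> \<in> U"
  shows "\<exists>F e. finite F \<and> (\<forall>f\<in>F. continuous_on {0..1} f) \<and> 0 < (e::real) \<and>
    (\<forall>\<nu>\<in>prob_measures. (\<forall>f\<in>F. \<bar>(\<integral>x. f x \<partial>\<nu>) - (\<integral>x. f x \<partial>\<mu>)\<bar> < e) \<longrightarrow> \<nu> \<in> U)"
proof -
  have "generate_topology_on {{\<mu> \<in> prob_measures. (\<integral>x. f x \<partial>\<mu>) \<in> U} | f U.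
      continuous_on {0..1} f \<and> open (U :: real set)} U"
    using assms(1) by (simp add: weak_star_topology_def openin_topology_generated_by_iff)
  then show ?thesis
    using assms(2)
  proof (induction rule: generate_topology_on.induct)
    case (Int A B)
    obtain F and e :: real where F:
      "finite F" "\<forall>f\<in>F. continuous_on {0..1} f" "0 < e"
      "\<forall>\<nu>\<in>prob_measures. (\<forall>f\<in>F. \<bar>(\<integral>x. f x \<partial>\<nu>) - (\<integral>x. f x \<partial>\<mu>)\<bar> < e) \<longrightarrow> \<nu> \<in> A"
      using Int.IH(1) Int.prems by blast
    obtain F' and e' :: real where F':
      "finite F'" "\<forall>f\<in>F'. continuous_on {0..1} f" "0 < e'"
      "\<forall>\<nu>\<in>prob_measures. (\<forall>f\<in>F'. \<bar>(\<integral>x. f x \<partial>\<nu>) - (\<integral>x. f x \<partial>\<mu>)\<bar> < e') \<longrightarrow> \<nu> \<in> B"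
      using Int.IH(2) Int.prems by blast
    from F F' show ?case
      by (intro exI[of _ "F \<union> F'"] exI[of _ "min e e'"]) auto
  next
    case (UN K)
    then obtain A where "A \<in> K" "\<mu> \<in> A" by auto
    from UN.IH[OF this] obtain F and e :: real where
      "finite F" "\<forall>f\<in>F. continuous_on {0..1} f" "0 < e"
      "\<forall>\<nu>\<in>prob_measures. (\<forall>f\<in>F. \<bar>(\<integral>x. f x \<partial>\<nu>) - (\<integral>x. f x \<partial>\<mu>)\<bar> < e) \<longrightarrow> \<nu> \<in> A"
      by blast
    with \<open>A \<in> K\<close> show ?case
      by (intro exI[of _ F] exI[of _ e]) auto
  next
    case (Basis S)
    then obtain f and V :: "real set" where fV: "S = {\<mu> \<in> prob_measures. (\<integral>x. f x \<partial>\<mu>) \<in> V}"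
      "continuous_on {0..1} f" "open V" by blast
    then obtain e where "0 < e" "\<And>y. \<bar>y - (\<integral>x. f x \<partial>\<mu>)\<bar> < e \<Longrightarrow> y \<in> V"
      using Basis.prems by (auto simp: open_dist dist_real_def)
    then show ?case
      using fV by (intro exI[of _ "{f}"] exI[of _ e]) auto
  qed simp
qed

lemma in_weak_star_closure_iff:
  assumes "S \<subseteq> prob_measures"
  shows "\<mu> \<in> weak_star_topology closure_of S \<longleftrightarrow> \<mu> \<in> prob_measures \<and>
    (\<forall>F e. finite F \<and> (\<forall>f\<in>F. continuous_on {0..1} f) \<and> 0 < (e::real) \<longrightarrow>
      (\<exists>\<nu>\<in>S. \<forall>f\<in>F. \<bar>(\<integral>x. f x \<partial>\<nu>) - (\<integral>x. f x \<partial>\<mu>)\<bar> < e))"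
    (is "?L \<longleftrightarrow> ?R")
proof
  assume L: ?L
  then have mu: "\<mu> \<in> prob_measures"
    by (simp add: in_closure_of topspace_weak_star_topology)
  moreover have "\<exists>\<nu>\<in>S. \<forall>f\<in>F. \<bar>(\<integral>x. f x \<partial>\<nu>) - (\<integral>x. f x \<partial>\<mu>)\<bar> < e"
    if F: "finite F" "\<forall>f\<in>F. continuous_on {0..1} f" "0 < (e::real)" for F e
  proof -
    define V :: "(real \<Rightarrow> real) \<Rightarrow> real measure set" where "V f = {\<nu> \<in> prob_measures. (\<integral>x. f x \<partial>\<nu>) \<in> ball (\<integral>x. f x \<partial>\<mu>) e}" for f
    have "openin weak_star_topology (V f)" if "f \<in> F" for f
      unfolding weak_star_topology_def V_def
      using F that by (intro topology_generated_by_Basis CollectI exI[of _ f]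
          exI[of _ "ball (\<integral>x. f x \<partial>\<mu>) e"]) auto
    then have "openin weak_star_topology (topspace weak_star_topology \<inter> \<Inter>(V ` F))"
      using F(1) by (intro openin_Int_Inter) auto
    moreover have "\<mu> \<in> topspace weak_star_topology \<inter> \<Inter>(V ` F)"
      using mu F(3) by (auto simp: V_def topspace_weak_star_topology)
    ultimately obtain \<nu> where "\<nu> \<in> S" "\<nu> \<in> topspace weak_star_topology \<inter> \<Inter>(V ` F)"
      using L unfolding in_closure_of by blast
    then show ?thesis
      by (intro bexI[of _ \<nu>]) (auto simp: V_def dist_real_def abs_minus_commute)
  qed
  ultimately show ?R by blast
next
  assume R: ?R
  have "\<exists>\<nu>\<in>S. \<nu> \<in> U" if U: "openin weak_star_topology U" "\<mu> \<in> U" for U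
  proof -
    obtain F and e :: real where
      "finite F" "\<forall>f\<in>F. continuous_on {0..1} f" "0 < e"
      "\<forall>\<nu>\<in>prob_measures. (\<forall>f\<in>F. \<bar>(\<integral>x. f x \<partial>\<nu>) - (\<integral>x. f x \<partial>\<mu>)\<bar> < e) \<longrightarrow> \<nu> \<in> U"
      using weak_star_open_nbhd[OF U] by blast
    moreover from calculation have "\<exists>\<nu>\<in>S. \<forall>f\<in>F. \<bar>(\<integral>x. f x \<partial>\<nu>) - (\<integral>x. f x \<partial>\<mu>)\<bar> < e"
      using R by (elim conjE allE[of _ F] allE[of _ e] impE) simp_all
    ultimately show ?thesis
      using assms by (elim bexE) (rule bexI, auto)
  qed
  moreover have "\<mu> \<in> prob_measures" using R by (rule conjunct1)
  ultimately show ?L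
    unfolding in_closure_of topspace_weak_star_topology by blast
qed

lemma invariant_measures_subset: "invariant_measures \<subseteq> prob_measures"
  by (auto simp: invariant_measures_def)

lemma space_prob_measure: "\<mu> \<in> prob_measures \<Longrightarrow> space \<mu> = {0..1}"
  using sets_eq_imp_space_eq[of \<mu> unit_borel]
  by (simp add: prob_measures_def space_restrict_space)

lemma measurable_on_unit:
  assumes "continuous_on {0..1} f" "sets \<mu> = sets unit_borel"
  shows "f \<in> borel_measurable \<mu>" "f \<in> borel_measurable unit_borel"
  using borel_measurable_continuous_on_restrict[OF assms(1)] measurable_cong_sets[OF assms(2) refl]
  by auto

lemma bounded_on_unit:
  fixes f :: "real \<Rightarrow> real"
  assumes "continuous_on {0..1} f"
  shows "\<exists>B. \<forall>x\<in>{0..1}. \<bar>f x\<bar> \<le> B"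
  using compact_imp_bounded[OF compact_continuous_image[OF assms compact_Icc]]
  by (auto simp: bounded_iff)

lemma integrable_on_unit:
  fixes f :: "real \<Rightarrow> real"
  assumes "continuous_on {0..1} f" "\<mu> \<in> prob_measures"
  shows "integrable \<mu> f"
proof -
  interpret prob_space \<mu> using assms(2) by (simp add: prob_measures_def)
  obtain B where "\<And>x. x \<in> {0..1} \<Longrightarrow> \<bar>f x\<bar> \<le> B"
    using bounded_on_unit[OF assms(1)] by blast
  then show ?thesis
    using assms measurable_on_unit[OF assms(1)]
    by (intro integrable_const_bound[of _ B]) (auto simp: prob_measures_def space_prob_measure)
qed

lemma emeasure_distr_gauss:
  assumes "\<mu> \<in> invariant_measures" "A \<in> sets unit_borel"
  shows "emeasure \<mu> (gauss_map -` A \<inter> {0..1}) = emeasure \<mu> A"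
proof -
  have m: "\<mu> \<in> prob_measures" and d: "distr \<mu> unit_borel gauss_map = \<mu>"
    using assms by (auto simp: invariant_measures_def)
  have "gauss_map \<in> measurable \<mu> unit_borel"
    using m gauss_map_measurable measurable_cong_sets[of \<mu> unit_borel unit_borel unit_borel]
    by (auto simp: prob_measures_def)
  then have "emeasure (distr \<mu> unit_borel gauss_map) A = emeasure \<mu> (gauss_map -` A \<inter> space \<mu>)"
    using assms(2) by (rule emeasure_distr)
  then show ?thesis
    using d m by (simp add: space_prob_measure)
qed

lemma invariant_measuresI:
  assumes "\<mu> \<in> prob_measures"
    "\<And>A. A \<in> sets unit_borel \<Longrightarrow> emeasure \<mu> (gauss_map -` A \<inter> {0..1}) = emeasure \<mu> A"
  shows "\<mu> \<in> invariant_measures"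
proof -
  have "gauss_map \<in> measurable \<mu> unit_borel"
    using assms(1) gauss_map_measurable measurable_cong_sets[of \<mu> unit_borel unit_borel unit_borel]
    by (auto simp: prob_measures_def)
  then have "distr \<mu> unit_borel gauss_map = \<mu>"
    using assms by (intro measure_eqI) (auto simp: emeasure_distr space_prob_measure prob_measures_def)
  then show ?thesis
    using assms(1) by (simp add: invariant_measures_def)
qed

lemma gauss_vimage_sets: "A \<in> sets unit_borel \<Longrightarrow> gauss_map -` A \<inter> {0..1} \<in> sets unit_borel"
  using measurable_sets[OF gauss_map_measurable, of A] by (simp add: space_restrict_space)

text \<open>An index is drawn from the weights, then a point from the chosen measure: as a
  \<open>bind\<close> over a probability mass function, sigma-additivity and integration are
  inherited. For nonnegative weights with sum 1, \<open>embed_pmf\<close> has the prescribed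
  values.\<close>

definition mixture :: "(nat \<Rightarrow> real) \<Rightarrow> (nat \<Rightarrow> real measure) \<Rightarrow> real measure" where
  "mixture w \<nu> = measure_pmf (embed_pmf w) \<bind> \<nu>"

context
  fixes w :: "nat \<Rightarrow> real" and \<nu> :: "nat \<Rightarrow> real measure"
  assumes w: "\<And>i. 0 \<le> w i" "w sums 1" and \<nu>: "\<And>i. \<nu> i \<in> prob_measures"
begin

lemma pmf_embed_weights: "pmf (embed_pmf w) i = w i"
proof (rule pmf_embed_pmf)
  show "(\<integral>\<^sup>+x. ennreal (w x) \<partial>count_space UNIV) = 1"
    using suminf_ennreal_eq[OF w] by (simp add: nn_integral_count_space_nat)
qed (rule w)

lemma mixture_kernel: "\<nu> \<in> measurable (measure_pmf (embed_pmf w)) (subprob_algebra unit_borel)"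
  using \<nu> by (auto simp: measurable_def space_subprob_algebra prob_measures_def
      prob_space_imp_subprob_space)

lemma mixture_prob: "mixture w \<nu> \<in> prob_measures"
  using measure_pmf.prob_space_bind[OF _ mixture_kernel] \<nu>
  by (auto simp: mixture_def prob_measures_def intro!: sets_bind)

lemma emeasure_mixture:
  assumes "A \<in> sets unit_borel"
  shows "emeasure (mixture w \<nu>) A = (\<Sum>i. ennreal (w i) * emeasure (\<nu> i) A)"
  unfolding mixture_def
  by (subst emeasure_bind[OF _ mixture_kernel assms])
    (auto simp: measure_pmf_eq_density nn_integral_density nn_integral_count_space_nat pmf_embed_weights)

lemma integral_mixture:
  fixes f :: "real \<Rightarrow> real"
  assumes f: "continuous_on {0..1} f"
  shows "(\<lambda>i. w i * (\<integral>x. f x \<partial>\<nu> i)) sums (\<integral>x. f x \<partial>mixture w \<nu>)"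
proof -
  obtain B where B: "\<And>x. x \<in> {0..1} \<Longrightarrow> \<bar>f x\<bar> \<le> B"
    using bounded_on_unit[OF f] by blast
  have bd: "\<bar>\<integral>x. f x \<partial>\<nu> i\<bar> \<le> B" for i
  proof -
    interpret prob_space "\<nu> i" using \<nu> by (simp add: prob_measures_def)
    have "\<bar>\<integral>x. f x \<partial>\<nu> i\<bar> \<le> (\<integral>x. \<bar>f x\<bar> \<partial>\<nu> i)" by simp
    also have "\<dots> \<le> (\<integral>x. B \<partial>\<nu> i)"
      by (rule integral_mono) (use integrable_on_unit[OF f \<nu>] B \<nu> in \<open>auto simp: space_prob_measure\<close>)
    finally show ?thesis by (simp add: prob_space)
  qed
  have "(\<integral>x. f x \<partial>mixture w \<nu>) = (\<integral>i. (\<integral>x. f x \<partial>\<nu> i) \<partial>measure_pmf (embed_pmf w))"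
    unfolding mixture_def
    by (rule integral_bind[OF measurable_on_unit(2)[OF f refl] _ mixture_kernel, of B 1])
      (use B \<nu> in \<open>auto simp: space_restrict_space measure_pmf.finite_measure_axioms prob_measures_def
          prob_space.emeasure_space_1\<close>)
  also have "\<dots> = (\<integral>i. w i * (\<integral>x. f x \<partial>\<nu> i) \<partial>count_space UNIV)"
    by (simp add: measure_pmf_eq_density integral_real_density pmf_embed_weights w)
  finally have eq: "(\<integral>x. f x \<partial>mixture w \<nu>) = \<dots>" .
  have "summable (\<lambda>i. norm (w i * (\<integral>x. f x \<partial>\<nu> i)))"
  proof (rule summable_comparison_test[of _ "\<lambda>i. w i * B"])
    show "summable (\<lambda>i. w i * B)"
      using w(2) by (intro summable_mult2) (auto simp: sums_iff)
    show "\<exists>N. \<forall>n\<ge>N. norm (norm (w n * (\<integral>x. f x \<partial>\<nu> n))) \<le> w n * B"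
      using bd w(1) by (auto simp: abs_mult intro!: mult_left_mono)
  qed
  then have "integrable (count_space UNIV) (\<lambda>i. w i * (\<integral>x. f x \<partial>\<nu> i))"
    by (simp add: integrable_count_space_nat_iff)
  from sums_integral_count_space_nat[OF this] show ?thesis
    by (simp add: eq)
qed

end

lemma mixture_invariant:
  assumes "\<And>i. 0 \<le> w i" "w sums 1" "\<And>i. \<nu> i \<in> invariant_measures"
  shows "mixture w \<nu> \<in> invariant_measures"
proof -
  have p: "\<nu> i \<in> prob_measures" for i
    using assms(3) invariant_measures_subset by blast
  show ?thesis
    by (rule invariant_measuresI[OF mixture_prob[OF assms(1,2) p]])
      (simp_all add: emeasure_mixture[OF assms(1,2) p] gauss_vimage_sets emeasure_distr_gauss[OF assms(3)])
qed

lemma eq_mixture: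
  assumes w: "\<And>i. 0 \<le> w i" "w sums 1" and \<nu>: "\<And>i. \<nu> i \<in> prob_measures" and \<mu>: "\<mu> \<in> prob_measures"
    and s: "\<forall>A\<in>sets unit_borel. (\<lambda>i. w i * measure (\<nu> i) A) sums measure \<mu> A"
  shows "\<mu> = mixture w \<nu>"
proof (rule measure_eqI)
  show "sets \<mu> = sets (mixture w \<nu>)"
    using \<mu> mixture_prob[OF w \<nu>] by (simp add: prob_measures_def)
  fix A assume "A \<in> sets \<mu>"
  then have A: "A \<in> sets unit_borel" using \<mu> by (simp add: prob_measures_def)
  have e: "emeasure \<kappa> A = ennreal (measure \<kappa> A)" if "\<kappa> \<in> prob_measures" for \<kappa>
  proof -
    interpret prob_space \<kappa> using that by (simp add: prob_measures_def)
    show ?thesis by (rule emeasure_eq_measure)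
  qed
  have "(\<Sum>i. ennreal (w i) * emeasure (\<nu> i) A) = (\<Sum>i. ennreal (w i * measure (\<nu> i) A))"
    by (simp add: e[OF \<nu>] ennreal_mult w)
  also have "\<dots> = ennreal (measure \<mu> A)"
    using s A w by (intro suminf_ennreal_eq) auto
  finally show "emeasure \<mu> A = emeasure (mixture w \<nu>) A"
    by (simp add: emeasure_mixture[OF w \<nu> A] e[OF \<mu>])
qed

text \<open>Each component is replaced by an invariant measure that matches it within e/2 on the
  test functions, uniformly in the index. The weights sum to 1, so the mixture of the replacements,
  again invariant, has error at most e/2; halving restores the strict inequality that an infinite
  sum loses.\<close>

lemma countable_hull_in_closure:
  assumes S: "S \<subseteq> weak_star_topology closure_of invariant_measures"
  shows "countable_convex_hull S \<subseteq> weak_star_topology closure_of invariant_measures"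
proof
  fix \<mu> assume "\<mu> \<in> countable_convex_hull S"
  then obtain w \<nu> where \<mu>: "\<mu> \<in> prob_measures" and w: "\<And>i. 0 \<le> w i" "w sums 1"
    and \<nu>: "\<And>i. \<nu> i \<in> S"
    and s: "\<forall>A\<in>sets unit_borel. (\<lambda>i. w i * measure (\<nu> i) A) sums measure \<mu> A"
    unfolding countable_convex_hull_def by blast
  note cl = in_weak_star_closure_iff[OF invariant_measures_subset]
  have \<nu>p: "\<nu> i \<in> prob_measures" for i
    using S \<nu>[of i] cl by blast
  have \<mu>eq: "\<mu> = mixture w \<nu>"
    using eq_mixture[OF w \<nu>p \<mu> s] .
  show "\<mu> \<in> weak_star_topology closure_of invariant_measures"
    unfolding cl
  proof (intro conjI allI impI \<mu>)
    fix F :: "(real \<Rightarrow> real) set" and e :: real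
    assume "finite F \<and> (\<forall>f\<in>F. continuous_on {0..1} f) \<and> 0 < e"
    then have F: "finite F" "\<And>f. f \<in> F \<Longrightarrow> continuous_on {0..1} f" "0 < e / 2" by auto
    have "\<exists>\<kappa>\<in>invariant_measures. \<forall>f\<in>F. \<bar>(\<integral>x. f x \<partial>\<kappa>) - (\<integral>x. f x \<partial>\<nu> i)\<bar> < e / 2" for i
      using S \<nu>[of i] F cl by blast
    then obtain \<kappa> where \<kappa>: "\<And>i. \<kappa> i \<in> invariant_measures"
      "\<And>i f. f \<in> F \<Longrightarrow> \<bar>(\<integral>x. f x \<partial>\<kappa> i) - (\<integral>x. f x \<partial>\<nu> i)\<bar> < e / 2" by metis
    have \<kappa>p: "\<kappa> i \<in> prob_measures" for i using \<kappa>(1) invariant_measures_subset by auto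
    have "\<bar>(\<integral>x. f x \<partial>mixture w \<kappa>) - (\<integral>x. f x \<partial>\<mu>)\<bar> \<le> e / 2" if "f \<in> F" for f
    proof -
      have d: "(\<lambda>i. w i * (\<integral>x. f x \<partial>\<kappa> i) - w i * (\<integral>x. f x \<partial>\<nu> i)) sums
          ((\<integral>x. f x \<partial>mixture w \<kappa>) - (\<integral>x. f x \<partial>\<mu>))"
        unfolding \<mu>eq by (intro sums_diff integral_mixture w \<nu>p \<kappa>p F that)
      have h: "(\<lambda>i. w i * (e / 2)) sums (1 * (e / 2))"
        by (intro sums_mult2 w)
      have b: "\<bar>w i * (\<integral>x. f x \<partial>\<kappa> i) - w i * (\<integral>x. f x \<partial>\<nu> i)\<bar> \<le> w i * (e / 2)" for i
        unfolding right_diff_distrib[symmetric] abs_mult abs_of_nonneg[OF w(1)]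
        by (intro mult_left_mono w less_imp_le \<kappa> that)
      have "(\<integral>x. f x \<partial>mixture w \<kappa>) - (\<integral>x. f x \<partial>\<mu>) \<le> 1 * (e / 2)"
        by (rule sums_le[OF _ d h]) (use b abs_le_D1 in blast)
      moreover have "- ((\<integral>x. f x \<partial>mixture w \<kappa>) - (\<integral>x. f x \<partial>\<mu>)) \<le> 1 * (e / 2)"
        by (rule sums_le[OF _ sums_minus[OF d] h]) (use b abs_le_D2 in blast)
      ultimately show ?thesis by linarith
    qed
    moreover have "mixture w \<kappa> \<in> invariant_measures"
      by (intro mixture_invariant w \<kappa>)
    moreover have "e / 2 < e" using F(3) by simp
    ultimately show "\<exists>\<kappa>\<in>invariant_measures. \<forall>f\<in>F. \<bar>(\<integral>x. f x \<partial>\<kappa>) - (\<integral>x. f x \<partial>\<mu>)\<bar> < e"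
      by (meson le_less_trans)
  qed
qed

subsection \<open>Finite continued fractions as limits of periodic orbits\<close>

text \<open>For positive digits, the inverse branch of an iterate of the Gauss map: a continued
  fraction with remainder \<open>y\<close> behind the last digit. Fixed points are values of
  periodic continued fractions.\<close>

fun tail_frac :: "nat list \<Rightarrow> real \<Rightarrow> real" where
  "tail_frac [] y = y"
| "tail_frac (a # as) y = 1 / (real a + tail_frac as y)"

lemma tail_frac_zero: "tail_frac as 0 = cont_frac as"
  by (induction as) auto

lemma tail_frac_append: "tail_frac (as @ bs) y = tail_frac as (tail_frac bs y)"
  by (induction as) auto

lemma tail_frac_range:
  assumes "\<forall>a\<in>set as. 1 \<le> a" "y \<in> {0..1}"
  shows "tail_frac as y \<in> {0..1}"
  using assms
proof (induction as)
  case (Cons a as)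
  then have "0 \<le> tail_frac as y" "1 \<le> real a" by auto
  then show ?case by (auto simp: divide_simps)
qed simp

lemma continuous_on_tail_frac:
  assumes "\<forall>a\<in>set as. 1 \<le> a"
  shows "continuous_on {0..1} (tail_frac as)"
  using assms
proof (induction as)
  case (Cons a as)
  have "real a + tail_frac as y \<noteq> 0" if "y \<in> {0..1}" for y
    using Cons.prems tail_frac_range[of as y] that by auto
  then show ?case
    using Cons by (auto intro!: continuous_intros)
qed (simp add: continuous_on_id)

text \<open>The value z = 1 must stay out: the Gauss map reads the digit a + 1 from 1/(a+1) and
  sends it to 0. This is one of the two places where \<open>gauss_rel\<close> exceeds the
  graph.\<close>

lemma gauss_map_inverse_digit:
  assumes "1 \<le> a" "0 \<le> z" "z < 1"
  shows "gauss_map (1 / (real a + z)) = z"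
proof -
  have "\<lfloor>real a + z\<rfloor> = int a"
    using assms by linarith
  then show ?thesis
    using assms by (simp add: gauss_map_def)
qed

section \<open>Averages over finitely many points\<close>

definition uniform_points :: "nat \<Rightarrow> (nat \<Rightarrow> real) \<Rightarrow> real measure" where
  "uniform_points n z = distr (measure_pmf (pmf_of_set {..n})) unit_borel z"

lemma measurable_points:
  "\<forall>k. z k \<in> {0..1} \<Longrightarrow> z \<in> measurable (measure_pmf p) unit_borel"
  by (auto simp: measurable_def space_restrict_space)

lemma uniform_points_prob:
  assumes "\<forall>k. z k \<in> {0..1}"
  shows "uniform_points n z \<in> prob_measures"
  using measure_pmf.prob_space_distr[OF measurable_points[OF assms]]
  by (auto simp: uniform_points_def prob_measures_def)

lemma emeasure_uniform_points:
  assumes "\<forall>k. z k \<in> {0..1}" "A \<in> sets unit_borel"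
  shows "emeasure (uniform_points n z) A = (\<Sum>k\<le>n. indicator A (z k)) / ennreal (real (n + 1))"
proof -
  have "emeasure (uniform_points n z) A = (\<integral>\<^sup>+k. indicator (z -` A) k \<partial>measure_pmf (pmf_of_set {..n}))"
    using assms measurable_points[OF assms(1), of "pmf_of_set {..n}"]
    by (simp add: uniform_points_def emeasure_distr)
  also have "\<dots> = (\<Sum>k\<le>n. indicator (z -` A) k) / ennreal (real (n + 1))"
    by (subst nn_integral_pmf_of_set)
      (auto simp flip: ennreal_of_nat_eq_real_of_nat)
  finally show ?thesis
    by (simp add: indicator_vimage comp_def)
qed

lemma integral_uniform_points:
  fixes f :: "real \<Rightarrow> real"
  assumes "\<forall>k. z k \<in> {0..1}" "continuous_on {0..1} f"
  shows "(\<integral>x. f x \<partial>uniform_points n z) = (\<Sum>k\<le>n. f (z k)) / real (n + 1)"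
  unfolding uniform_points_def
  by (subst integral_distr[OF measurable_points[OF assms(1)] measurable_on_unit(2)[OF assms(2) refl]])
    (subst integral_pmf_of_set, auto)

lemma fcf_measure_eq_uniform_points:
  assumes "\<forall>a\<in>set as. 1 \<le> a"
  shows "fcf_measure as = uniform_points (length as) (fcf_point as)"
proof (rule measure_eqI)
  show "sets (fcf_measure as) = sets (uniform_points (length as) (fcf_point as))"
    by (simp add: sets_fcf_measure uniform_points_def)
  fix A assume "A \<in> sets (fcf_measure as)"
  then show "emeasure (fcf_measure as) A = emeasure (uniform_points (length as) (fcf_point as)) A"
    using fcf_point_in_unit[OF assms]
    by (subst emeasure_uniform_points) (auto simp: emeasure_fcf_measure sets_fcf_measure)
qed

text \<open>Precomposition with the map advances every index by one, and by periodicity this cyclic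
  shift preserves the sum.\<close>

lemma uniform_points_invariant:
  assumes z: "\<forall>k. z k \<in> {0..1}" and G: "\<And>k. k \<le> n \<Longrightarrow> gauss_map (z k) = z (Suc k)"
    and per: "z (Suc n) = z 0"
  shows "uniform_points n z \<in> invariant_measures"
proof (rule invariant_measuresI[OF uniform_points_prob[OF z]])
  fix A assume A: "A \<in> sets unit_borel"
  have "(\<Sum>k\<le>n. indicator (gauss_map -` A \<inter> {0..1}) (z k)) = (\<Sum>k\<le>n. indicator A (z (Suc k)) :: ennreal)"
    using z G by (intro sum.cong) (auto simp: indicator_def)
  also have "\<dots> = (\<Sum>k\<le>n. indicator A (z k))"
  proof -
    have "(\<Sum>k\<le>n. indicator A (z (Suc k)) :: ennreal) = (\<Sum>k<n. indicator A (z (Suc k))) + indicator A (z (Suc n))"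
      unfolding lessThan_Suc_atMost[symmetric] by (rule sum.lessThan_Suc)
    then show ?thesis
      by (simp only: per sum.atMost_shift[of _ n] add.commute)
  qed
  finally show "emeasure (uniform_points n z) (gauss_map -` A \<inter> {0..1}) = emeasure (uniform_points n z) A"
    by (simp add: emeasure_uniform_points[OF z] A gauss_vimage_sets)
qed

text \<open>With n the length of \<open>as\<close>, the cycle of the word
  \<open>as @ [Suc N]\<close> has n + 1 points, counted with repetition. As N grows, the point with
  leading digit \<open>Suc N\<close> tends to 0 and the others, by continuity of
  \<open>tail_frac\<close>, to the values of the nonempty suffixes of \<open>as\<close>: the n + 1
  atoms of the FCF measure.\<close>

lemma fcf_measure_in_closure:
  assumes as: "\<forall>a\<in>set as. 1 \<le> a"
  shows "fcf_measure as \<in> weak_star_topology closure_of invariant_measures"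
proof -
  define n where "n = length as"
  define w where "w N = as @ [Suc N]" for N
  have wpos: "\<forall>a\<in>set (drop k (w N)). 1 \<le> a" for k N
    using as set_drop_subset[of k "w N"] by (auto simp: w_def)
  \<comment> \<open>Brouwer's theorem in dimension one supplies the periodic point.\<close>
  have "\<exists>y\<in>{0..1}. tail_frac (w N) y = y" for N
    by (rule brouwer[of "{0..1::real}" "tail_frac (w N)"])
      (use wpos[of 0 N] continuous_on_tail_frac tail_frac_range[of "w N"] in auto)
  then obtain y where y: "\<And>N. y N \<in> {0..1}" "\<And>N. tail_frac (w N) (y N) = y N"
    by metis
  define z where "z N k = tail_frac (drop k (w N)) (y N)" for N k
  have zI: "\<forall>k. z N k \<in> {0..1}" for N
    using tail_frac_range[OF wpos y(1)] by (simp add: z_def)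
  have z0: "z N 0 = y N" and zn: "z N (Suc n) = y N" for N
    using y(2) by (simp_all add: z_def w_def n_def)
  have step: "\<exists>a\<ge>1. z N k = 1 / (real a + z N (Suc k))" if "k \<le> n" for N k
  proof -
    have "k < length (w N)" using that by (simp add: w_def n_def)
    then have "drop k (w N) = w N ! k # drop (Suc k) (w N)"
      by (simp add: Cons_nth_drop_Suc)
    moreover then have "w N ! k \<ge> 1" using wpos[of k N] by simp
    ultimately show ?thesis by (auto simp: z_def)
  qed
  \<comment> \<open>The aim is z < 1, as \<open>gauss_map_inverse_digit\<close> requires. It follows
    from positivity of the successor; the equality of \<open>z N (Suc n)\<close> and
    \<open>z N 0\<close> covers the last index.\<close>
  have pos: "0 < z N k" if k: "k \<le> n" for N k
  proof -
    obtain a where "a \<ge> 1" "z N k = 1 / (real a + z N (Suc k))" using step[OF k] by blast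
    then show ?thesis using zI[of N] by (auto simp: add_pos_nonneg)
  qed
  have pos': "0 < z N (Suc k)" if "k \<le> n" for N k
    using pos[of "Suc k" N] pos[of 0 N] z0 zn that by (cases "k = n") auto
  have lt1: "z N k < 1" if k: "k \<le> n" for N k
  proof -
    obtain a where "a \<ge> 1" "z N k = 1 / (real a + z N (Suc k))" using step[OF k] by blast
    then show ?thesis using pos'[OF k, of N] by auto
  qed
  have lt1': "z N (Suc k) < 1" if "k \<le> n" for N k
    using lt1[of "Suc k" N] lt1[of 0 N] z0 zn that by (cases "k = n") auto
  have "gauss_map (z N k) = z N (Suc k)" if k: "k \<le> n" for N k
  proof -
    obtain a where "a \<ge> 1" "z N k = 1 / (real a + z N (Suc k))" using step[OF k] by blast
    then show ?thesis using gauss_map_inverse_digit lt1'[OF k] zI[of N] by simp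
  qed
  then have inv: "uniform_points n (z N) \<in> invariant_measures" for N
    using z0 zn by (intro uniform_points_invariant zI) auto
  have "(\<lambda>N. 1 / (real (Suc N) + y N)) \<longlonglongrightarrow> 0"
  proof (rule tendsto_sandwich[OF _ _ tendsto_const LIMSEQ_inverse_real_of_nat])
    show "\<forall>\<^sub>F N in sequentially. 1 / (real (Suc N) + y N) \<le> inverse (real (Suc N))"
      using y(1) by (auto simp: inverse_eq_divide intro!: always_eventually divide_left_mono mult_pos_pos add_pos_nonneg)
  qed (use y(1) in \<open>auto intro!: always_eventually\<close>)
  moreover have "1 / (real (Suc N) + y N) \<in> {0..1}" for N
    using y(1)[of N] by (auto simp: divide_simps)
  ultimately have "(\<lambda>N. tail_frac (drop k as) (1 / (real (Suc N) + y N))) \<longlonglongrightarrow> tail_frac (drop k as) 0" for k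
    using as set_drop_subset[of k as]
    by (intro continuous_on_tendsto_compose[OF continuous_on_tail_frac]) (auto intro!: always_eventually)
  then have lim: "(\<lambda>N. z N k) \<longlonglongrightarrow> cont_frac (drop k as)" if "k \<le> n" for k
    using that by (simp add: z_def w_def n_def tail_frac_append tail_frac_zero)
  have fI: "cont_frac (drop k as) \<in> {0..1}" for k
    using cont_frac_range[of "drop k as"] as set_drop_subset[of k as] by auto
  have conv: "(\<lambda>N. \<integral>x. f x \<partial>uniform_points n (z N)) \<longlonglongrightarrow> (\<integral>x. f x \<partial>fcf_measure as)"
    if f: "continuous_on {0..1} f" for f :: "real \<Rightarrow> real"
  proof -
    have "(\<lambda>N. (\<Sum>k\<le>n. f (z N k)) / real (n + 1)) \<longlonglongrightarrow> (\<Sum>k\<le>n. f (cont_frac (drop k as))) / real (n + 1)"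
      using zI fI by (intro tendsto_intros continuous_on_tendsto_compose[OF f] lim)
        (auto intro!: always_eventually)
    \<comment> \<open>Suffixes are numbered by the digits removed in \<open>z\<close>, by the digits
      kept in \<open>fcf_point\<close>; hence the reversal.\<close>
    also have "(\<Sum>k\<le>n. f (cont_frac (drop k as))) = (\<Sum>k\<le>n. f (fcf_point as k))"
      by (rule sum.reindex_bij_witness[of _ "\<lambda>k. n - k" "\<lambda>k. n - k"]) (auto simp: fcf_point_def n_def)
    finally show ?thesis
      using fcf_point_in_unit[OF as] f zI
      by (simp add: fcf_measure_eq_uniform_points[OF as] integral_uniform_points n_def)
  qed
  show ?thesis
    unfolding in_weak_star_closure_iff[OF invariant_measures_subset]
  proof (intro conjI allI impI)
    show "fcf_measure as \<in> prob_measures"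
      using fcf_measures_subset as by (auto simp: fcf_measures_def)
    fix F :: "(real \<Rightarrow> real) set" and e :: real
    assume F: "finite F \<and> (\<forall>f\<in>F. continuous_on {0..1} f) \<and> 0 < e"
    then have "\<forall>f\<in>F. \<forall>\<^sub>F N in sequentially.
        \<bar>(\<integral>x. f x \<partial>uniform_points n (z N)) - (\<integral>x. f x \<partial>fcf_measure as)\<bar> < e"
      using conv unfolding tendsto_iff dist_real_def by blast
    then have "\<forall>\<^sub>F N in sequentially. \<forall>f\<in>F.
        \<bar>(\<integral>x. f x \<partial>uniform_points n (z N)) - (\<integral>x. f x \<partial>fcf_measure as)\<bar> < e"
      using F by (intro eventually_ball_finite) auto
    then obtain N where "\<forall>f\<in>F. \<bar>(\<integral>x. f x \<partial>uniform_points n (z N)) - (\<integral>x. f x \<partial>fcf_measure as)\<bar> < e"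
      using eventually_happens'[OF sequentially_bot] by blast
    then show "\<exists>\<nu>\<in>invariant_measures. \<forall>f\<in>F. \<bar>(\<integral>x. f x \<partial>\<nu>) - (\<integral>x. f x \<partial>fcf_measure as)\<bar> < e"
      using inv by blast
  qed
qed

lemma irrational_invariant_in_closure:
  "irrational_invariant_measures \<subseteq> weak_star_topology closure_of invariant_measures"
proof -
  have "irrational_invariant_measures \<subseteq> topspace weak_star_topology \<inter> invariant_measures"
    using invariant_measures_subset
    by (auto simp: irrational_invariant_measures_def topspace_weak_star_topology)
  then show ?thesis
    using closure_of_subset_Int by fastforce
qed

lemma hull_subset_closure:
  "countable_convex_hull (irrational_invariant_measures \<union> fcf_measures) \<subseteq>
    weak_star_topology closure_of invariant_measures"
  by (rule countable_hull_in_closure)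
    (use irrational_invariant_in_closure fcf_measure_in_closure in \<open>auto simp: fcf_measures_def\<close>)

subsection \<open>Weak limits of probability measures\<close>

text \<open>For closed nonempty F the functions max 0 (1 - n * infdist x F) decrease to the
  indicator of F. So integrals of continuous functions determine the measure of closed sets, an
  intersection-stable generator of the Borel sets.\<close>

lemma finite_measure_eqI_continuous:
  fixes M N :: "'a::metric_space measure"
  assumes fin: "finite_measure M" "finite_measure N" and sets: "sets M = sets borel" "sets N = sets borel"
    and eq: "\<And>f :: 'a \<Rightarrow> real. continuous_on UNIV f \<Longrightarrow> (\<And>x. 0 \<le> f x \<and> f x \<le> 1) \<Longrightarrow>
      (\<integral>x. f x \<partial>M) = (\<integral>x. f x \<partial>N)"
  shows "M = N"
proof -
  have *: "(\<lambda>n. \<integral>x. max 0 (1 - real n * infdist x F) \<partial>L) \<longlonglongrightarrow> measure L F"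
    if L: "finite_measure L" "sets L = sets borel" and F: "closed F" "F \<noteq> {}"
    for L :: "'a measure" and F
  proof -
    interpret finite_measure L by (rule L)
    have [measurable]: "(\<lambda>x. max 0 (1 - real n * infdist x F)) \<in> borel_measurable L" for n
      unfolding measurable_cong_sets[OF L(2) refl]
      by (intro borel_measurable_continuous_onI continuous_intros)
    have [measurable]: "F \<in> sets L"
      using F L by auto
    have "(\<lambda>n. \<integral>x. max 0 (1 - real n * infdist x F) \<partial>L) \<longlonglongrightarrow> (\<integral>x. indicator F x \<partial>L)"
    proof (rule integral_dominated_convergence[where w = "\<lambda>_. 1"])
      show "AE x in L. (\<lambda>n. max 0 (1 - real n * infdist x F)) \<longlonglongrightarrow> indicator F x"
      proof (rule AE_I2)
        fix x
        show "(\<lambda>n. max 0 (1 - real n * infdist x F)) \<longlonglongrightarrow> indicator F x"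
        proof (cases "x \<in> F")
          case False
          then have d: "0 < infdist x F"
            using F by (meson infdist_pos_not_in_closed)
          then obtain n0 :: nat where n0: "1 / infdist x F < n0"
            using reals_Archimedean2 by blast
          have "max 0 (1 - real n * infdist x F) = 0" if "n \<ge> n0" for n
          proof -
            have "1 / infdist x F \<le> real n" using n0 that by linarith
            then show ?thesis using d by (simp add: divide_simps split: if_splits)
          qed
          then show ?thesis
            using False by (intro tendsto_eventually eventually_sequentiallyI[of n0]) auto
        qed simp
      qed
      show "AE x in L. norm (max 0 (1 - real n * infdist x F)) \<le> 1" for n
        by (auto simp: infdist_nonneg)
    qed auto
    then show ?thesis by simp
  qed
  have cl: "emeasure M F = emeasure N F" if F: "closed F" for F
  proof (cases "F = {}")
    case False
    have "(\<integral>x. max 0 (1 - real n * infdist x F) \<partial>M) = (\<integral>x. max 0 (1 - real n * infdist x F) \<partial>N)" for n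
      by (intro eq continuous_intros) (auto simp: infdist_nonneg)
    then have "measure M F = measure N F"
      using *[OF fin(1) sets(1) F False] *[OF fin(2) sets(2) F False] by (simp add: LIMSEQ_unique)
    then show ?thesis
      using fin by (simp add: finite_measure.emeasure_eq_measure)
  qed simp
  show ?thesis
  proof (rule measure_eqI_generator_eq[where E = "{F. closed F}" and \<Omega> = UNIV and A = "\<lambda>_. UNIV"])
    show "Int_stable {F::'a set. closed F}"
      by (auto simp: Int_stable_def)
    show "sets M = sigma_sets UNIV {F. closed F}" "sets N = sigma_sets UNIV {F. closed F}"
      using sets by (simp_all add: borel_eq_closed)
    show "emeasure M UNIV \<noteq> \<infinity>" 
      using fin(1) by (simp add: finite_measure.emeasure_finite)
  qed (auto simp: cl)
qed

lemma integral_close: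
  fixes f g :: "real \<Rightarrow> real"
  assumes \<kappa>: "\<kappa> \<in> prob_measures" and f: "continuous_on {0..1} f" and g: "continuous_on {0..1} g"
    and d: "\<And>x. x \<in> {0..1} \<Longrightarrow> \<bar>f x - g x\<bar> < e"
  shows "\<bar>(\<integral>x. f x \<partial>\<kappa>) - (\<integral>x. g x \<partial>\<kappa>)\<bar> \<le> e"
proof -
  have "prob_space \<kappa>"
    using \<kappa> by (simp add: prob_measures_def)
  then have one: "(\<integral>x. e \<partial>\<kappa>) = e"
    by (simp add: prob_space.prob_space)
  note fi = integrable_on_unit[OF f \<kappa>] and gi = integrable_on_unit[OF g \<kappa>]
  have "\<bar>(\<integral>x. f x \<partial>\<kappa>) - (\<integral>x. g x \<partial>\<kappa>)\<bar> = \<bar>\<integral>x. f x - g x \<partial>\<kappa>\<bar>"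
    by (simp add: Bochner_Integration.integral_diff[OF fi gi])
  also have "\<dots> \<le> (\<integral>x. \<bar>f x - g x\<bar> \<partial>\<kappa>)" by simp
  also have "\<dots> \<le> (\<integral>x. e \<partial>\<kappa>)"
  proof (rule integral_mono)
    show "integrable \<kappa> (\<lambda>x. \<bar>f x - g x\<bar>)"
      using fi gi by simp
    show "integrable \<kappa> (\<lambda>x. e)"
      using \<open>prob_space \<kappa>\<close> by (simp add: prob_space.finite_measure finite_measure.integrable_const)
    show "\<bar>f x - g x\<bar> \<le> e" if "x \<in> space \<kappa>" for x
      using d[of x] that \<kappa> by (simp add: space_prob_measure)
  qed
  finally show ?thesis unfolding one .
qed

text \<open>Polynomials are uniformly dense on the unit interval by Weierstrass. That countably many
  test functions suffice is what lets \<open>closure_lift\<close> work with a sequence.\<close>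

lemma prob_measures_eqI_moments:
  assumes \<mu>: "\<mu> \<in> prob_measures" and \<nu>: "\<nu> \<in> prob_measures"
    and mom: "\<And>k. (\<integral>x. x ^ k \<partial>\<mu>) = (\<integral>x. x ^ k \<partial>\<nu>)"
  shows "\<mu> = \<nu>"
proof -
  have id: "(\<lambda>x. x) \<in> measurable \<kappa> borel" if "\<kappa> \<in> prob_measures" for \<kappa> :: "real measure"
    using that measurable_on_unit(1)[of "\<lambda>x. x" \<kappa>] by (simp add: prob_measures_def)
  have fin: "finite_measure (distr \<kappa> borel (\<lambda>x. x))" if "\<kappa> \<in> prob_measures" for \<kappa> :: "real measure"
    by (intro prob_space.finite_measure prob_space.prob_space_distr id that)
      (use that in \<open>simp add: prob_measures_def\<close>)
  have "distr \<mu> borel (\<lambda>x. x) = distr \<nu> borel (\<lambda>x. x)"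
  proof (rule finite_measure_eqI_continuous)
    fix f :: "real \<Rightarrow> real"
    assume fc: "continuous_on UNIV f"
    have f: "continuous_on {0..1} f" "f \<in> borel_measurable borel"
      using continuous_on_subset[OF fc subset_UNIV] borel_measurable_continuous_onI[OF fc] by simp_all
    have "\<bar>(\<integral>x. f x \<partial>\<mu>) - (\<integral>x. f x \<partial>\<nu>)\<bar> \<le> 2 * e" if e: "0 < e" for e
    proof -
      obtain g where g: "real_polynomial_function g" "\<And>x. x \<in> {0..1} \<Longrightarrow> \<bar>f x - g x\<bar> < e"
        using Stone_Weierstrass_real_polynomial_function[OF compact_Icc f(1) e] by blast
      then obtain a n where gs: "g = (\<lambda>x. \<Sum>i\<le>n. a i * x ^ i)"
        unfolding real_polynomial_function_iff_sum by blast
      have gc: "continuous_on {0..1} g"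
        unfolding gs by (intro continuous_intros)
      have "(\<integral>x. g x \<partial>\<kappa>) = (\<Sum>i\<le>n. a i * (\<integral>x. x ^ i \<partial>\<kappa>))" if "\<kappa> \<in> prob_measures" for \<kappa>
      proof -
        have "integrable \<kappa> (\<lambda>x. x ^ i)" for i
          by (intro integrable_on_unit[OF _ that] continuous_intros)
        then show ?thesis
          by (simp add: gs)
      qed
      then have "(\<integral>x. g x \<partial>\<mu>) = (\<integral>x. g x \<partial>\<nu>)"
        using \<mu> \<nu> mom by simp
      then show ?thesis
        using integral_close[OF \<mu> f(1) gc g(2)] integral_close[OF \<nu> f(1) gc g(2)] by linarith
    qed
    \<comment> \<open>With e a third of the discrepancy, the bound 2 * e is below the discrepancy
      unless the latter is 0.\<close>
    from this[of "\<bar>(\<integral>x. f x \<partial>\<mu>) - (\<integral>x. f x \<partial>\<nu>)\<bar> / 3"]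
    have "(\<integral>x. f x \<partial>\<mu>) = (\<integral>x. f x \<partial>\<nu>)" by (cases "(\<integral>x. f x \<partial>\<mu>) = (\<integral>x. f x \<partial>\<nu>)") auto
    then show "(\<integral>x. f x \<partial>distr \<mu> borel (\<lambda>x. x)) = (\<integral>x. f x \<partial>distr \<nu> borel (\<lambda>x. x))"
      by (simp add: integral_distr[OF id f(2)] \<mu> \<nu>)
  qed (use fin \<mu> \<nu> in auto)
  moreover have "emeasure \<kappa> A = emeasure (distr \<kappa> borel (\<lambda>x. x)) A"
    if "\<kappa> \<in> prob_measures" "A \<in> sets unit_borel" for \<kappa> A
  proof -
    have "A \<in> sets borel" "A \<subseteq> {0..1}"
      using that(2) by (auto simp: sets_restrict_space_iff)
    then show ?thesis
      using that by (simp add: emeasure_distr[OF id] space_prob_measure Int_absorb2)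
  qed
  ultimately show ?thesis
    using \<mu> \<nu> by (intro measure_eqI) (auto simp: prob_measures_def)
qed

text \<open>Prokhorov's theorem on a compact space, reduced to Helly selection: \<open>code\<close>
  identifies K with a compact set C of reals, the image measures are tight because C is bounded, and
  the limit law is carried back by the inverse of \<open>code\<close>.\<close>

lemma weak_sequential_compactness:
  fixes K :: "'a::{second_countable_topology, metric_space} set" and code :: "'a \<Rightarrow> real" and \<nu> :: "nat \<Rightarrow> 'a measure"
  assumes K: "compact K" and code: "continuous_on UNIV code" "inj_on code K"
    and \<nu>: "\<And>n. prob_space (\<nu> n)" "\<And>n. sets (\<nu> n) = sets borel" "\<And>n. AE x in \<nu> n. x \<in> K"
  obtains r :: "nat \<Rightarrow> nat" and m :: "'a measure" where "strict_mono r" "prob_space m" "sets m = sets borel"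
    "AE x in m. x \<in> K"
    "\<And>h :: 'a \<Rightarrow> real. continuous_on UNIV h \<Longrightarrow> (\<lambda>n. \<integral>x. h x \<partial>\<nu> (r n)) \<longlonglongrightarrow> (\<integral>x. h x \<partial>m)"
proof -
  interpret \<nu>: prob_space "\<nu> n" for n by (rule \<nu>)
  define C where "C = (code ` K :: real set)"
  have cK: "continuous_on K code"
    using code(1) continuous_on_subset by blast
  then have "compact C"
    unfolding C_def by (rule compact_continuous_image) (rule K)
  then have C: "closed C" "bounded C"
    by (auto simp: compact_imp_closed compact_imp_bounded)
  have code_m: "code \<in> borel_measurable (\<nu> n)" for n
    unfolding measurable_cong_sets[OF \<nu>(2) refl] by (rule borel_measurable_continuous_onI[OF code(1)])
  obtain g where "homeomorphism K C code g"
    using homeomorphism_compact[OF K cK C_def[symmetric] code(2)] by blast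
  then have g: "continuous_on C g" "\<And>x. x \<in> K \<Longrightarrow> g (code x) = x" "\<And>t. t \<in> C \<Longrightarrow> g t \<in> K"
    unfolding homeomorphism_def by auto
  have Kne: "K \<noteq> {}"
    using \<nu>(3)[of 0] \<nu>.AE_False by auto
  then obtain x0 where x0: "x0 \<in> K" by blast
  define P where "P n = distr (\<nu> n) borel code" for n
  have P: "real_distribution (P n)" for n
    unfolding P_def by (intro \<nu>.real_distribution_distr code_m)
  have PC: "AE t in P n. t \<in> C" for n
    unfolding P_def
    by (subst AE_distr_iff[OF code_m]) (use \<nu>(3)[of n] C in \<open>auto simp: C_def\<close>)
  obtain B where B: "\<And>t. t \<in> C \<Longrightarrow> \<bar>t\<bar> \<le> B"
    using C(2) by (auto simp: bounded_iff)
  have "tight P"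
    unfolding tight_def
  proof (intro conjI allI impI P)
    fix e :: real assume "0 < e"
    \<comment> \<open>Tightness is stated with intervals open on the left, so the left end lies
      strictly below -B; the absolute value on the right keeps the interval nonempty for either sign
      of B.\<close>
    have "measure (P n) {- B - 1 <.. \<bar>B\<bar>} = 1" for n
    proof -
      interpret real_distribution "P n" by (rule P)
      have "AE t in P n. t \<in> {- B - 1 <.. \<bar>B\<bar>}"
        using PC[of n] by eventually_elim (use B in force)
      then show ?thesis by (subst prob_eq_1) auto
    qed
    moreover have "- B - 1 < \<bar>B\<bar>" by linarith
    ultimately show "\<exists>a b. a < b \<and> (\<forall>n. 1 - e < measure (P n) {a<..b})"
      using \<open>0 < e\<close> by (intro exI[of _ "- B - 1"] exI[of _ "\<bar>B\<bar>"]) simp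
  qed
  then obtain r M where r: "strict_mono r" and M: "real_distribution M" and "weak_conv_m (P \<circ> id \<circ> r) M"
    using tight_imp_convergent_subsubsequence[of P id] strict_mono_id by blast
  then have wc: "weak_conv_m (\<lambda>n. P (r n)) M"
    by (simp add: comp_def)
  interpret M: real_distribution M by (rule M)
  have lim: "(\<lambda>n. \<integral>t. H t \<partial>P (r n)) \<longlonglongrightarrow> (\<integral>t. H t \<partial>M)"
    if "continuous_on UNIV H" "\<And>t. \<bar>H t\<bar> \<le> D" for H :: "real \<Rightarrow> real" and D
    using weak_conv_imp_integral_bdd_continuous_conv[OF P M wc, of H D] that
    by (simp add: continuous_on_eq_continuous_at)
  have Cne: "C \<noteq> {}" using Kne by (simp add: C_def)
  \<comment> \<open>The distance to C, truncated to a bounded test function, has integral 0 under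
    every \<open>P n\<close>, hence under the limit; as C is closed, the limit law sits on
    C.\<close>
  have MC: "AE t in M. t \<in> C"
  proof -
    have "(\<integral>t. min 1 (infdist t C) \<partial>P n) = 0" for n
      using PC[of n] by (intro integral_eq_zero_AE) (auto elim!: eventually_mono)
    then have "(\<integral>t. min 1 (infdist t C) \<partial>M) = 0"
      using lim[of "\<lambda>t. min 1 (infdist t C)" 1]
      by (simp add: infdist_nonneg continuous_intros LIMSEQ_const_iff)
    moreover have "integrable M (\<lambda>t. min 1 (infdist t C))"
      by (rule M.integrable_const_bound[of _ 1])
        (auto simp: infdist_nonneg measurable_cong_sets[OF M.events_eq_borel refl]
          intro!: borel_measurable_continuous_onI continuous_intros)
    ultimately have "AE t in M. min 1 (infdist t C) = 0"
      by (subst (asm) integral_nonneg_eq_0_iff_AE) (auto simp: infdist_nonneg)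
    then show ?thesis
      by eventually_elim (use C Cne in \<open>auto simp: in_closed_iff_infdist_zero min_def split: if_splits\<close>)
  qed
  \<comment> \<open>Outside C, a null set of the limit law, a constant value completes the inverse
    of \<open>code\<close> to a Borel map on the line.\<close>
  define g' where "g' t = (if t \<in> C then g t else x0)" for t
  have g'_m: "g' \<in> measurable M borel"
    unfolding g'_def measurable_cong_sets[OF M.events_eq_borel refl]
    by (rule borel_measurable_continuous_on_if) (use C g in auto)
  define m where "m = distr M borel g'"
  show thesis
  proof (rule that[OF r])
    show "prob_space m"
      unfolding m_def by (rule M.prob_space_distr[OF g'_m])
    show "sets m = sets borel" by (simp add: m_def)
    show "AE x in m. x \<in> K"
      unfolding m_def
      by (subst AE_distr_iff[OF g'_m]) (use K g x0 in \<open>auto simp: g'_def compact_imp_closed\<close>)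
    fix h :: "'a \<Rightarrow> real" assume h: "continuous_on UNIV h"
    then have hg: "continuous_on C (\<lambda>t. h (g t))"
      by (rule continuous_on_compose2[OF _ g(1)]) auto
    have "bounded (h ` K)"
      using h by (intro compact_imp_bounded compact_continuous_image K) (rule continuous_on_subset, auto)
    then obtain D where D: "\<And>x. x \<in> K \<Longrightarrow> \<bar>h x\<bar> \<le> D"
      by (auto simp: bounded_iff)
    then have D0: "0 \<le> D" using x0 by force
    \<comment> \<open>Weak convergence tests functions on the whole line, so \<open>h\<close>
      transported to C is extended by Tietze with the same bound.\<close>
    obtain H where H: "continuous_on UNIV H" "\<And>t. t \<in> C \<Longrightarrow> H t = h (g t)" "\<And>t. norm (H t) \<le> D"
      by (rule Tietze[OF hg, of UNIV D]) (use C D0 D g(3) in auto)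
    have h_m: "h \<in> borel_measurable borel"
      by (rule borel_measurable_continuous_onI[OF h])
    have H_m: "H \<in> borel_measurable borel"
      by (rule borel_measurable_continuous_onI[OF H(1)])
    have "(\<integral>t. H t \<partial>P n) = (\<integral>x. h x \<partial>\<nu> n)" for n
    proof -
      have "(\<integral>t. H t \<partial>P n) = (\<integral>x. H (code x) \<partial>\<nu> n)"
        unfolding P_def by (rule integral_distr[OF code_m H_m])
      also have "\<dots> = (\<integral>x. h x \<partial>\<nu> n)"
      proof (rule integral_cong_AE)
        show "(\<lambda>x. H (code x)) \<in> borel_measurable (\<nu> n)"
          by (rule measurable_compose[OF code_m H_m])
        show "h \<in> borel_measurable (\<nu> n)"
          using h_m by (simp add: measurable_cong_sets[OF \<nu>(2) refl])
        show "AE x in \<nu> n. H (code x) = h x"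
          using \<nu>(3)[of n] by eventually_elim (simp add: H(2) g(2) C_def)
      qed
      finally show ?thesis .
    qed
    moreover have "(\<integral>t. H t \<partial>M) = (\<integral>x. h x \<partial>m)"
    proof -
      have "(\<integral>x. h x \<partial>m) = (\<integral>t. h (g' t) \<partial>M)"
        unfolding m_def by (rule integral_distr[OF g'_m h_m])
      also have "\<dots> = (\<integral>t. H t \<partial>M)"
      proof (rule integral_cong_AE)
        show "(\<lambda>t. h (g' t)) \<in> borel_measurable M"
          by (rule measurable_compose[OF g'_m h_m])
        show "H \<in> borel_measurable M"
          using H_m by (simp add: measurable_cong_sets[OF M.events_eq_borel refl])
        show "AE t in M. h (g' t) = H t"
          using MC by eventually_elim (simp add: H(2) g'_def)
      qed
      finally show ?thesis by simp
    qed
    ultimately show "(\<lambda>n. \<integral>x. h x \<partial>\<nu> (r n)) \<longlonglongrightarrow> (\<integral>x. h x \<partial>m)"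
      using lim[OF H(1), of D] H(3) by simp
  qed
qed

subsection \<open>The closure of the orbit space\<close>

text \<open>The closure of the graph of \<open>gauss_map\<close>: it adds (0, z) for every z and
  (1/(a+1), 1) for every a \<ge> 1. The equation is written as a product, which rules out y = 0 by
  itself.\<close>

definition gauss_rel :: "(real \<times> real) set" where
  "gauss_rel = {(y, z). y \<in> {0..1} \<and> z \<in> {0..1} \<and> (y = 0 \<or> (\<exists>a::nat\<ge>1. y * (real a + z) = 1))}"

lemma gauss_rel_cases:
  assumes "(y, z) \<in> gauss_rel"
  obtains "y = 0" "z \<in> {0..1}" | a :: nat where "1 \<le> a" "y * (real a + z) = 1" "0 < y" "y \<le> 1" "z \<in> {0..1}"
  using assms by (fastforce simp: gauss_rel_def less_le)

text \<open>Where y \<noteq> 0, the condition puts 1/y - z into the closed set of positive integers,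
  so its violation is open; at y = 0 nothing can be violated.\<close>

lemma closed_gauss_rel: "closed gauss_rel"
proof -
  define U where "U = {p :: real \<times> real. fst p \<noteq> 0}"
  have "open (U \<inter> (\<lambda>p. 1 / fst p - snd p) -` (- (real ` {1..})))"
  proof (rule continuous_open_preimage)
    show "continuous_on U (\<lambda>p. 1 / fst p - snd p)"
      by (auto simp: U_def intro!: continuous_intros)
    show "open U"
      unfolding U_def by (intro open_Collect_neq continuous_intros)
    show "open (- (real ` {1..}))"
      by (intro open_Compl closed_of_nat_image)
  qed
  moreover have "gauss_rel = ({0..1} \<times> {0..1}) \<inter> - (U \<inter> (\<lambda>p. 1 / fst p - snd p) -` (- (real ` {1..})))"
  proof (intro set_eqI iffI)
    fix p assume "p \<in> ({0..1} \<times> {0..1}) \<inter> - (U \<inter> (\<lambda>p. 1 / fst p - snd p) -` (- (real ` {1..})))"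
    then obtain y z where p: "p = (y, z)" "y \<in> {0..1}" "z \<in> {0..1}"
      "y = 0 \<or> (\<exists>a::nat\<ge>1. 1 / y - z = real a)"
      by (cases p) (auto simp: U_def)
    have "y * (real a + z) = 1" if "1 / y - z = real a" "y \<noteq> 0" for a
      using that by (simp add: field_simps)
    then show "p \<in> gauss_rel"
      using p unfolding gauss_rel_def by blast
  next
    fix p assume "p \<in> gauss_rel"
    then obtain y z where p: "p = (y, z)" "y \<in> {0..1}" "z \<in> {0..1}"
      "y = 0 \<or> (\<exists>a::nat\<ge>1. y * (real a + z) = 1)"
      by (cases p) (auto simp: gauss_rel_def)
    have "1 / y - z = real a" if "y * (real a + z) = 1" for a
      using that by (cases "y = 0") (auto simp: field_simps)
    then have "y = 0 \<or> 1 / y - z \<in> real ` {1..}"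
      using p(4) by auto
    then show "p \<in> ({0..1} \<times> {0..1}) \<inter> - (U \<inter> (\<lambda>p. 1 / fst p - snd p) -` (- (real ` {1..})))"
      using p(1-3) by (auto simp: U_def)
  qed
  ultimately show ?thesis
    by (metis closed_Compl closed_Int closed_Times closed_atLeastAtMost)
qed

definition orbit_space :: "(nat \<Rightarrow> real) set" where
  "orbit_space = {y. \<forall>i. (y i, y (Suc i)) \<in> gauss_rel}"

lemma orbit_spaceD:
  assumes "y \<in> orbit_space"
  shows "(y i, y (Suc i)) \<in> gauss_rel" "y i \<in> {0..1}"
  using assms by (auto simp: orbit_space_def gauss_rel_def)

lemma closed_orbit_space: "closed orbit_space"
proof -
  have "orbit_space = (\<Inter>i. (\<lambda>y. (y i, y (Suc i))) -` gauss_rel)"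
    by (auto simp: orbit_space_def)
  also have "closed \<dots>"
    by (intro closed_INT ballI closed_vimage closed_gauss_rel continuous_intros) simp_all
  finally show ?thesis .
qed

lemma compact_orbit_space: "compact orbit_space"
proof -
  have "compactin (product_topology (\<lambda>_. euclidean) UNIV) (PiE UNIV (\<lambda>_::nat. {0..1::real}))"
    unfolding compactin_PiE by simp
  then have "compact (PiE UNIV (\<lambda>_::nat. {0..1::real}))"
    by (simp add: euclidean_product_topology)
  moreover have "orbit_space = PiE UNIV (\<lambda>_::nat. {0..1::real}) \<inter> orbit_space"
    using orbit_spaceD(2) by fastforce
  ultimately show ?thesis
    using closed_orbit_space compact_Int_closed by metis
qed

text \<open>If \<open>y = 1 / (a + z)\<close>, then \<open>1 - y z - (j + 1) y = y (a - j - 1)\<close>; the factor \<open>j + 3\<close> makes the truncation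
  to \<open>[0,1]\<close> equal to 1 or 0 according to whether \<open>a > j + 1\<close>. So \<open>digit_bit\<close> is continuous, yet
  two-valued on \<open>gauss_rel\<close>, and the bits embed the orbit space into the Cantor set.\<close>

definition digit_bit :: "nat \<Rightarrow> real \<Rightarrow> real \<Rightarrow> real" where
  "digit_bit j y z = max 0 (min 1 ((real j + 3) * (1 - y * z - (real j + 1) * y)))"

lemma digit_bit_range: "0 \<le> digit_bit j y z" "digit_bit j y z \<le> 1"
  by (auto simp: digit_bit_def)

lemma digit_bit_zero: "digit_bit j 0 z = 1"
  by (simp add: digit_bit_def)

lemma digit_bit_digit:
  assumes "y * (real a + z) = 1" "0 < y" "z \<in> {0..1}"
  shows "digit_bit j y z = (if j + 2 \<le> a then 1 else 0)"
proof -
  have e: "1 - y * z - (real j + 1) * y = y * (real a - (real j + 1))"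
    using assms(1) by (simp add: algebra_simps)
  show ?thesis
  proof (cases "j + 2 \<le> a")
    case True
    define b where "b = real a - (real j + 1)"
    have b: "b \<ge> 1" using True by (simp add: b_def)
    \<comment> \<open>Since b = a - j - 1 \<ge> 1, this yields a + z \<le> b + (j + 2) \<le> (j + 3)
      * b, the origin of the factor j + 3.\<close>
    have "(real j + 2) * 1 \<le> (real j + 2) * b"
      using b by (intro mult_left_mono) auto
    then have "real a + z \<le> (real j + 3) * b"
      using assms(3) by (simp add: b_def algebra_simps)
    then have "y * (real a + z) \<le> y * ((real j + 3) * b)"
      using assms(2) by (intro mult_left_mono) auto
    then have "1 \<le> (real j + 3) * (y * b)"
      using assms(1) by (simp add: mult.left_commute)
    then show ?thesis
      using True by (simp add: digit_bit_def e b_def)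
  next
    case False
    then have "y * (real a - (real j + 1)) \<le> 0"
      using assms(2) by (intro mult_nonneg_nonpos) auto
    then have "(real j + 3) * (y * (real a - (real j + 1))) \<le> 0"
      by (rule mult_nonneg_nonpos[rotated]) simp
    then show ?thesis
      using False by (simp add: digit_bit_def e)
  qed
qed

text \<open>At the first disagreement the terms differ by (1/3)^N, while all later differences
  together amount to at most half of that. In base 2 the tail could compensate.\<close>

lemma ternary_expansion_unique:
  fixes a b :: "nat \<Rightarrow> real"
  assumes a: "\<And>n. a n \<in> {0, 1}" and b: "\<And>n. b n \<in> {0, 1}"
    and eq: "(\<Sum>n. a n * (1/3) ^ n) = (\<Sum>n. b n * (1/3) ^ n)"
  shows "a n = b n"
proof (rule ccontr)
  assume ne: "a n \<noteq> b n"
  define N where "N = (LEAST n. a n \<noteq> b n)"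
  have N: "a N \<noteq> b N"
    unfolding N_def by (rule LeastI[of "\<lambda>n. a n \<noteq> b n", OF ne])
  have least: "a k = b k" if "k < N" for k
    using not_less_Least[of k "\<lambda>n. a n \<noteq> b n"] that unfolding N_def by simp
  have bd: "norm (d k * (1/3) ^ k) \<le> (1/3) ^ k" if "\<And>n. \<bar>d n\<bar> \<le> 1" for d :: "nat \<Rightarrow> real" and k
    using that[of k] by (simp add: abs_mult mult_left_le_one_le)
  have geo: "summable (\<lambda>k. (1/3 :: real) ^ k)"
    by (rule summable_geometric) simp
  have sm: "summable (\<lambda>k. d k * (1/3) ^ k)" if "\<And>n. \<bar>d n\<bar> \<le> 1" for d :: "nat \<Rightarrow> real"
    by (rule summable_comparison_test[OF exI[of _ 0] geo]) (use bd[of d] that in blast)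
  define c where "c n = a n - b n" for n
  have c1: "\<bar>c n\<bar> \<le> 1" for n
    using a[of n] b[of n] by (auto simp: c_def)
  have cz: "(\<Sum>n. c n * (1/3) ^ n) = 0"
  proof -
    have "\<bar>a n\<bar> \<le> 1" "\<bar>b n\<bar> \<le> 1" for n using a[of n] b[of n] by auto
    then show ?thesis
      using eq by (simp add: c_def left_diff_distrib suminf_diff[symmetric] sm)
  qed
  define t where "t = (\<Sum>k. c (Suc k + N) * (1/3) ^ (Suc k))"
  have sN: "summable (\<lambda>k. c (k + N) * (1/3) ^ k)"
    using c1 by (intro sm)
  have "(\<Sum>k. c (k + N) * (1/3) ^ (k + N)) = (\<Sum>n. c n * (1/3) ^ n) - (\<Sum>k<N. c k * (1/3) ^ k)"
    by (rule suminf_minus_initial_segment[OF sm[OF c1]])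
  also have "\<dots> = 0"
    using cz least by (simp add: c_def)
  finally have "(\<Sum>k. (c (k + N) * (1/3) ^ k) * (1/3) ^ N) = 0"
    by (simp add: power_add mult.assoc)
  then have "(\<Sum>k. c (k + N) * (1/3) ^ k) = 0"
    using suminf_mult2[OF sN, of "(1/3)^N"] by simp
  then have t: "c N = - t"
    using suminf_split_head[OF sN] by (simp add: t_def)
  have h: "(\<lambda>k. (1/3 :: real) ^ Suc k) sums (1/2)"
    using sums_mult[OF geometric_sums[of "1/3::real"], of "1/3"] by simp
  have s1: "summable (\<lambda>k. norm (c (Suc k + N) * (1/3) ^ Suc k))"
    by (rule summable_comparison_test[OF _ sums_summable[OF h]])
      (use c1 in \<open>auto simp: abs_mult intro!: mult_left_le_one_le mult_nonneg_nonneg\<close>)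
  have "norm t \<le> (\<Sum>k. norm (c (Suc k + N) * (1/3) ^ Suc k))"
    unfolding t_def by (rule summable_norm[OF s1])
  also have "\<dots> \<le> (\<Sum>k. (1/3) ^ Suc k)"
    by (rule suminf_le[OF _ s1 sums_summable[OF h]])
      (use c1 in \<open>auto simp: abs_mult intro!: mult_left_le_one_le mult_nonneg_nonneg\<close>)
  also have "\<dots> = 1/2" using h by (simp add: sums_iff)
  finally have "\<bar>c N\<bar> \<le> 1/2" by (simp add: t)
  moreover have "\<bar>c N\<bar> = 1" using N a[of N] b[of N] by (auto simp: c_def)
  ultimately show False by simp
qed

text \<open>\<open>prod_decode\<close> lists all pairs of a coordinate and a bit, so one series
  stores all digits. Each bit reads two consecutive coordinates because a value 1/(a+1) alone does
  not determine its digit.\<close>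

definition orbit_code :: "(nat \<Rightarrow> real) \<Rightarrow> real" where
  "orbit_code y = (\<Sum>n. digit_bit (snd (prod_decode n)) (y (fst (prod_decode n))) (y (Suc (fst (prod_decode n)))) * (1/3) ^ n)"

lemma continuous_on_orbit_code: "continuous_on UNIV orbit_code"
proof -
  have "uniform_limit UNIV (\<lambda>N y. \<Sum>n<N. digit_bit (snd (prod_decode n)) (y (fst (prod_decode n)))
      (y (Suc (fst (prod_decode n)))) * (1/3) ^ n) orbit_code sequentially"
    unfolding orbit_code_def
  proof (rule Weierstrass_m_test)
    show "summable (\<lambda>n. (1/3 :: real) ^ n)"
      by (rule summable_geometric) simp
    show "norm (digit_bit (snd (prod_decode n)) (y (fst (prod_decode n))) (y (Suc (fst (prod_decode n)))) * (1/3) ^ n)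
        \<le> (1/3) ^ n" for n and y :: "nat \<Rightarrow> real"
      using digit_bit_range by (simp add: abs_mult mult_left_le_one_le)
  qed
  then show ?thesis
    by (rule uniform_limit_theorem[rotated])
      (auto simp: digit_bit_def intro!: always_eventually continuous_intros)
qed

text \<open>Equal bits mean equal digits, a zero counting as an infinite digit. Passing from index i
  + 1 to i then multiplies the difference by y_i z_i. This may be close to 1, but y_i y_(i+1) \<le>
  1/2 makes two steps contract by 1/4.\<close>

lemma same_digits_imp_eq:
  assumes y: "y \<in> orbit_space" and z: "z \<in> orbit_space"
    and bits: "\<And>i j. digit_bit j (y i) (y (Suc i)) = digit_bit j (z i) (z (Suc i))"
  shows "y = z"
proof -
  have step: "\<bar>y i - z i\<bar> = y i * z i * \<bar>y (Suc i) - z (Suc i)\<bar>" for i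
  proof -
    note yr = orbit_spaceD(1)[OF y, of i] and zr = orbit_spaceD(1)[OF z, of i]
    \<comment> \<open>Bit a - 1 is the first one that vanishes for the digit a, whereas all bits of
      a zero are 1.\<close>
    have digit: False if "y' = 0" "z' * (real a + w) = 1" "1 \<le> a" "0 < z'" "w \<in> {0..1}"
      "digit_bit (a - 1) y' v = digit_bit (a - 1) z' w" for y' z' v w :: real and a :: nat
      using that digit_bit_digit[of z' a w "a - 1"] by (simp add: digit_bit_zero split: if_splits)
    show ?thesis
      using yr
    proof (cases rule: gauss_rel_cases)
      case 1
      have "z i = 0"
        using zr
      proof (cases rule: gauss_rel_cases)
        case (2 b)
        then show ?thesis using digit[OF 1(1) 2(2,1,3,5) bits] by simp
      qed
      then show ?thesis using 1 by simp
    next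
      case (2 a)
      note a = this
      show ?thesis
        using zr
      proof (cases rule: gauss_rel_cases)
        case 1
        then show ?thesis
          using digit[OF 1(1) a(2,1,3,5) bits[symmetric]] by simp
      next
        case (2 b)
        have "a = b"
        proof (rule ccontr)
          assume "a \<noteq> b"
          \<comment> \<open>This bit is 0 for the smaller digit and 1 for the larger one.\<close>
          then have "digit_bit (min a b - 1) (y i) (y (Suc i)) \<noteq> digit_bit (min a b - 1) (z i) (z (Suc i))"
            using digit_bit_digit[OF a(2,3,5), of "min a b - 1"] digit_bit_digit[OF 2(2,3,5), of "min a b - 1"] a(1) 2(1)
            by (auto split: if_splits)
          then show False using bits by simp
        qed
        then have "y i - z i = y i * (z i * (real a + z (Suc i))) - z i * (y i * (real a + y (Suc i)))"
          using 2(2) a(2) by simp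
        also have "\<dots> = (y i * z i) * (z (Suc i) - y (Suc i))"
          by (simp add: algebra_simps)
        finally show ?thesis
          using a(3) 2(3) by (simp add: abs_mult abs_minus_commute)
      qed
    qed
  qed
  \<comment> \<open>The two terms a y_i and y_i y_(i+1) add up to 1, and the second is the smaller
    because y_(i+1) \<le> 1 \<le> a.\<close>
  have half: "y i * y (Suc i) \<le> 1 / 2" if y: "y \<in> orbit_space" for y i
    using orbit_spaceD(1)[OF y, of i]
  proof (cases rule: gauss_rel_cases)
    case (2 a)
    have "y i * y (Suc i) \<le> y i * real a"
      using 2 by (intro mult_left_mono) auto
    then show ?thesis
      using 2(2) by (simp add: algebra_simps)
  qed simp
  have quarter: "\<bar>y i - z i\<bar> \<le> \<bar>y (Suc (Suc i)) - z (Suc (Suc i))\<bar> / 4" for i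
  proof -
    have "(y i * y (Suc i)) * (z i * z (Suc i)) \<le> (1/2) * (1/2)"
      using half[OF y, of i] half[OF z, of i] orbit_spaceD(2)[OF y] orbit_spaceD(2)[OF z]
      by (intro mult_mono) auto
    then have "((y i * y (Suc i)) * (z i * z (Suc i))) * \<bar>y (Suc (Suc i)) - z (Suc (Suc i))\<bar>
        \<le> 1/4 * \<bar>y (Suc (Suc i)) - z (Suc (Suc i))\<bar>"
      by (intro mult_right_mono) auto
    then show ?thesis
      by (simp add: step[of i] step[of "Suc i"] mult_ac)
  qed
  have bound: "\<bar>y i - z i\<bar> \<le> (1/4) ^ k" for i k
  proof (induction k arbitrary: i)
    case 0
    show ?case using orbit_spaceD(2)[OF y, of i] orbit_spaceD(2)[OF z, of i] by auto
  next
    case (Suc k)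
    show ?case using quarter[of i] Suc.IH[of "Suc (Suc i)"] by simp
  qed
  have "\<bar>y i - z i\<bar> \<le> 0" for i
  proof (rule LIMSEQ_le_const)
    show "(\<lambda>k. (1/4 :: real) ^ k) \<longlonglongrightarrow> 0" by (rule LIMSEQ_realpow_zero) auto
  qed (use bound in auto)
  then show ?thesis by (auto intro!: ext)
qed

lemma digit_bit_01:
  assumes "(y, z) \<in> gauss_rel"
  shows "digit_bit j y z \<in> {0, 1}"
  using assms by (cases rule: gauss_rel_cases) (auto simp: digit_bit_zero digit_bit_digit)

lemma inj_on_orbit_code: "inj_on orbit_code orbit_space"
proof (rule inj_onI)
  fix y z assume yz: "y \<in> orbit_space" "z \<in> orbit_space" "orbit_code y = orbit_code z"
  have b: "digit_bit (snd (prod_decode n)) (y (fst (prod_decode n))) (y (Suc (fst (prod_decode n)))) =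
      digit_bit (snd (prod_decode n)) (z (fst (prod_decode n))) (z (Suc (fst (prod_decode n))))" for n
    by (rule ternary_expansion_unique)
      (use yz digit_bit_01 orbit_spaceD(1) in \<open>auto simp: orbit_code_def\<close>)
  have "digit_bit j (y i) (y (Suc i)) = digit_bit j (z i) (z (Suc i))" for i j
    using b[of "prod_encode (i, j)"] by simp
  then show "y = z"
    by (rule same_digits_imp_eq[OF yz(1,2)])
qed

subsection \<open>Lifting limits of invariant measures\<close>

definition orbit_shift :: "(nat \<Rightarrow> real) \<Rightarrow> nat \<Rightarrow> real" where
  "orbit_shift y = (\<lambda>i. y (Suc i))"

lemma continuous_on_orbit_shift: "continuous_on UNIV orbit_shift"
  unfolding orbit_shift_def
  by (rule continuous_on_coordinatewise_then_product) simp

lemma orbit_shift_in_orbit_space: "y \<in> orbit_space \<Longrightarrow> orbit_shift y \<in> orbit_space"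
  by (simp add: orbit_space_def orbit_shift_def)

definition gauss_orbit :: "real \<Rightarrow> nat \<Rightarrow> real" where
  "gauss_orbit x = (\<lambda>i. (gauss_map ^^ i) x)"

lemma orbit_shift_gauss_orbit: "orbit_shift (gauss_orbit x) = gauss_orbit (gauss_map x)"
  by (simp add: orbit_shift_def gauss_orbit_def funpow_swap1)

lemma gauss_map_range: "x \<in> {0..1} \<Longrightarrow> gauss_map x \<in> {0..1}"
  using measurable_space[OF gauss_map_measurable] by (simp add: space_restrict_space)

lemma gauss_map_rel:
  assumes x: "x \<in> {0..1}"
  shows "(x, gauss_map x) \<in> gauss_rel"
proof (cases "x = 0")
  case False
  then have x0: "0 < x" "1 \<le> 1 / x" using x by auto
  then have "1 \<le> \<lfloor>1 / x\<rfloor>" by (simp add: le_floor_iff)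
  then have "1 \<le> nat \<lfloor>1 / x\<rfloor>" "real (nat \<lfloor>1 / x\<rfloor>) = of_int \<lfloor>1 / x\<rfloor>" by linarith+
  moreover have "x * (of_int \<lfloor>1 / x\<rfloor> + gauss_map x) = 1"
    using x0 by (simp add: gauss_map_def)
  ultimately have "\<exists>a::nat\<ge>1. x * (real a + gauss_map x) = 1"
    by (intro exI[of _ "nat \<lfloor>1 / x\<rfloor>"]) simp
  then show ?thesis
    using x gauss_map_range[OF x] by (simp add: gauss_rel_def)
qed (use gauss_map_range[OF x] in \<open>simp add: gauss_rel_def\<close>)

lemma gauss_orbit_in_orbit_space:
  assumes "x \<in> {0..1}"
  shows "gauss_orbit x \<in> orbit_space"
proof -
  have "gauss_orbit x i \<in> {0..1}" for i
    by (induction i) (use assms gauss_map_range in \<open>simp_all add: gauss_orbit_def del: atLeastAtMost_iff\<close>)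
  then show ?thesis
    using gauss_map_rel by (auto simp: orbit_space_def gauss_orbit_def simp del: atLeastAtMost_iff)
qed

lemma gauss_orbit_measurable: "gauss_orbit \<in> borel_measurable unit_borel"
proof -
  have "(gauss_map ^^ i) \<in> measurable unit_borel unit_borel" for i
  proof (induction i)
    case (Suc i)
    show ?case
      unfolding funpow.simps by (rule measurable_comp[OF Suc gauss_map_measurable])
  qed (simp add: id_def)
  moreover have "(\<lambda>x. x) \<in> measurable unit_borel borel"
    by (rule measurable_restrict_space1) simp
  ultimately have "(\<lambda>x. gauss_orbit x i) \<in> borel_measurable unit_borel" for i
    unfolding gauss_orbit_def by (rule measurable_compose)
  then show ?thesis
    by (rule measurable_coordinatewise_then_product)
qed

text \<open>Projection to coordinate 0, truncated because the measures live on all real sequences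
  while the target is the unit interval; on \<open>orbit_space\<close> nothing is cut off.\<close>

definition unit_clamp :: "(nat \<Rightarrow> real) \<Rightarrow> real" where
  "unit_clamp y = max 0 (min 1 (y 0))"

lemma continuous_on_unit_clamp: "continuous_on UNIV unit_clamp"
  unfolding unit_clamp_def by (intro continuous_intros) simp

lemma unit_clamp_measurable: "unit_clamp \<in> measurable borel unit_borel"
proof (rule measurable_restrict_space2)
  show "unit_clamp \<in> borel_measurable borel"
    by (rule borel_measurable_continuous_onI[OF continuous_on_unit_clamp])
qed (auto simp: unit_clamp_def)

lemma unit_clamp_eq: "y 0 \<in> {0..1} \<Longrightarrow> unit_clamp y = y 0"
  by (simp add: unit_clamp_def)

text \<open>Invariant measures are pushed along \<open>gauss_orbit\<close>, which intertwines
  \<open>gauss_map\<close> with the shift. The shift is continuous, so its invariance passes to a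
  limit on the compact orbit space, and coordinate 0 recovers the given measure.\<close>

lemma closure_lift:
  assumes "\<mu> \<in> weak_star_topology closure_of invariant_measures"
  obtains m :: "(nat \<Rightarrow> real) measure" where "prob_space m" "sets m = sets borel"
    "AE y in m. y \<in> orbit_space" "distr m borel orbit_shift = m" "distr m unit_borel unit_clamp = \<mu>"
proof -
  have \<mu>: "\<mu> \<in> prob_measures"
    and cl: "\<And>F e. finite F \<Longrightarrow> \<forall>f\<in>F. continuous_on {0..1} f \<Longrightarrow> 0 < (e::real) \<Longrightarrow>
      \<exists>\<nu>\<in>invariant_measures. \<forall>f\<in>F. \<bar>(\<integral>x. f x \<partial>\<nu>) - (\<integral>x. f x \<partial>\<mu>)\<bar> < e"
    using assms unfolding in_weak_star_closure_iff[OF invariant_measures_subset] by auto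
  \<comment> \<open>Matching the moments up to order n within 1/(n+1) extracts a sequence from the
    closure: every single moment converges along it.\<close>
  define near where "near n \<kappa> \<longleftrightarrow> \<kappa> \<in> invariant_measures \<and>
      (\<forall>k\<le>n. \<bar>(\<integral>x. x ^ k \<partial>\<kappa>) - (\<integral>x. x ^ k \<partial>\<mu>)\<bar> < inverse (real (Suc n)))" for n and \<kappa> :: "real measure"
  have "\<exists>\<kappa>. near n \<kappa>" for n
  proof -
    have "\<exists>\<kappa>\<in>invariant_measures. \<forall>f\<in>(\<lambda>k x. x ^ k) ` {..n}.
        \<bar>(\<integral>x. f x \<partial>\<kappa>) - (\<integral>x. f x \<partial>\<mu>)\<bar> < inverse (real (Suc n))"
      by (rule cl) (auto intro!: continuous_intros)
    then show ?thesis
      unfolding near_def by blast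
  qed
  then obtain \<nu> where near: "\<And>n. near n (\<nu> n)"
    using choice[of near] by blast
  have \<nu>: "\<nu> n \<in> invariant_measures"
    "k \<le> n \<Longrightarrow> \<bar>(\<integral>x. x ^ k \<partial>\<nu> n) - (\<integral>x. x ^ k \<partial>\<mu>)\<bar> < inverse (real (Suc n))" for n k
    using near[of n] by (auto simp only: near_def)
  have mom: "(\<lambda>n. \<integral>x. x ^ k \<partial>\<nu> n) \<longlonglongrightarrow> (\<integral>x. x ^ k \<partial>\<mu>)" for k
    unfolding LIM_zero_iff[of _ "\<integral>x. x ^ k \<partial>\<mu>", symmetric]
  proof (rule Lim_null_comparison[OF _ LIMSEQ_inverse_real_of_nat])
    show "\<forall>\<^sub>F n in sequentially. norm ((\<integral>x. x ^ k \<partial>\<nu> n) - (\<integral>x. x ^ k \<partial>\<mu>)) \<le> inverse (real (Suc n))"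
      using \<nu>(2) by (auto intro!: eventually_sequentiallyI[of k] less_imp_le simp del: of_nat_Suc)
  qed
  have \<nu>p: "\<nu> n \<in> prob_measures" for n
    using \<nu>(1) invariant_measures_subset by blast
  have \<nu>s: "sets (\<nu> n) = sets unit_borel" and \<nu>prob: "prob_space (\<nu> n)" for n
    using \<nu>p[of n] by (simp_all add: prob_measures_def)
  have om: "gauss_orbit \<in> borel_measurable (\<nu> n)" for n
    using gauss_orbit_measurable by (simp add: measurable_cong_sets[OF \<nu>s refl])
  define \<kappa> where "\<kappa> n = distr (\<nu> n) borel gauss_orbit" for n
  have \<kappa>: "prob_space (\<kappa> n)" "sets (\<kappa> n) = sets borel" "AE y in \<kappa> n. y \<in> orbit_space" for n
  proof -
    show "prob_space (\<kappa> n)"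
      unfolding \<kappa>_def by (rule prob_space.prob_space_distr[OF \<nu>prob om])
    show "AE y in \<kappa> n. y \<in> orbit_space"
      unfolding \<kappa>_def
      by (subst AE_distr_iff[OF om])
        (auto simp: closed_orbit_space space_prob_measure[OF \<nu>p] intro!: AE_I2 gauss_orbit_in_orbit_space)
  qed (simp add: \<kappa>_def)
  obtain r m where r: "strict_mono (r :: nat \<Rightarrow> nat)" and m: "prob_space m" "sets m = sets borel"
    "AE y in m. y \<in> orbit_space"
    and lim: "\<And>h :: (nat \<Rightarrow> real) \<Rightarrow> real. continuous_on UNIV h \<Longrightarrow>
      (\<lambda>n. \<integral>y. h y \<partial>\<kappa> (r n)) \<longlonglongrightarrow> (\<integral>y. h y \<partial>m)"
  proof (rule weak_sequential_compactness[of orbit_space orbit_code \<kappa>,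
        OF compact_orbit_space continuous_on_orbit_code inj_on_orbit_code \<kappa>], goal_cases)
    case (1 r m)
    show ?case by (rule 1(1)[OF 1(2-6)])
  qed
  have int\<kappa>: "(\<integral>y. h y \<partial>\<kappa> n) = (\<integral>x. h (gauss_orbit x) \<partial>\<nu> n)"
    if "continuous_on UNIV h" for h :: "(nat \<Rightarrow> real) \<Rightarrow> real" and n
    unfolding \<kappa>_def by (rule integral_distr[OF om borel_measurable_continuous_onI[OF that]])
  have sm: "orbit_shift \<in> measurable m borel"
    using borel_measurable_continuous_onI[OF continuous_on_orbit_shift]
    by (simp add: measurable_cong_sets[OF m(2) refl])
  have cm: "unit_clamp \<in> measurable m unit_borel"
    using unit_clamp_measurable by (simp add: measurable_cong_sets[OF m(2) refl])
  have shift: "distr m borel orbit_shift = m"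
  proof (rule finite_measure_eqI_continuous)
    show "finite_measure (distr m borel orbit_shift)"
      by (rule prob_space.finite_measure[OF prob_space.prob_space_distr[OF m(1) sm]])
    show "finite_measure m"
      by (rule prob_space.finite_measure[OF m(1)])
    fix h :: "(nat \<Rightarrow> real) \<Rightarrow> real" assume h: "continuous_on UNIV h"
    have hm: "h \<in> borel_measurable borel"
      by (rule borel_measurable_continuous_onI[OF h])
    have hs: "continuous_on UNIV (\<lambda>y. h (orbit_shift y))"
      by (rule continuous_on_compose2[OF h continuous_on_orbit_shift]) simp
    have "(\<integral>y. h (orbit_shift y) \<partial>\<kappa> n) = (\<integral>y. h y \<partial>\<kappa> n)" for n
    proof -
      have ho: "(\<lambda>x. h (gauss_orbit x)) \<in> borel_measurable unit_borel"
        by (rule measurable_compose[OF gauss_orbit_measurable hm])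
      have gm: "gauss_map \<in> measurable (\<nu> n) unit_borel"
        using gauss_map_measurable by (simp add: measurable_cong_sets[OF \<nu>s refl])
      have "(\<integral>y. h (orbit_shift y) \<partial>\<kappa> n) = (\<integral>x. h (gauss_orbit (gauss_map x)) \<partial>\<nu> n)"
        by (simp add: int\<kappa>[OF hs] orbit_shift_gauss_orbit)
      also have "\<dots> = (\<integral>x. h (gauss_orbit x) \<partial>distr (\<nu> n) unit_borel gauss_map)"
        by (rule integral_distr[OF gm ho, symmetric])
      also have "\<dots> = (\<integral>y. h y \<partial>\<kappa> n)"
        using \<nu>(1)[of n] by (simp add: int\<kappa>[OF h] invariant_measures_def)
      finally show ?thesis .
    qed
    then have "(\<integral>y. h (orbit_shift y) \<partial>m) = (\<integral>y. h y \<partial>m)"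
      using lim[OF hs] lim[OF h] by (simp add: LIMSEQ_unique)
    then show "(\<integral>y. h y \<partial>distr m borel orbit_shift) = (\<integral>y. h y \<partial>m)"
      by (simp add: integral_distr[OF sm hm])
  qed (simp_all add: m)
  have proj: "distr m unit_borel unit_clamp = \<mu>"
  proof (rule prob_measures_eqI_moments)
    show "distr m unit_borel unit_clamp \<in> prob_measures"
      using prob_space.prob_space_distr[OF m(1) cm] by (simp add: prob_measures_def)
    fix k
    have c: "continuous_on UNIV (\<lambda>y. unit_clamp y ^ k)"
      by (intro continuous_intros continuous_on_unit_clamp)
    have "(\<integral>y. unit_clamp y ^ k \<partial>\<kappa> n) = (\<integral>x. x ^ k \<partial>\<nu> n)" for n
      unfolding int\<kappa>[OF c]
      by (rule Bochner_Integration.integral_cong[OF refl])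
        (simp add: unit_clamp_def gauss_orbit_def space_prob_measure[OF \<nu>p])
    then have "(\<lambda>n. \<integral>x. x ^ k \<partial>\<nu> (r n)) \<longlonglongrightarrow> (\<integral>y. unit_clamp y ^ k \<partial>m)"
      using lim[OF c] by simp
    moreover have "(\<lambda>n. \<integral>x. x ^ k \<partial>\<nu> (r n)) \<longlonglongrightarrow> (\<integral>x. x ^ k \<partial>\<mu>)"
      using LIMSEQ_subseq_LIMSEQ[OF mom r] by (simp add: comp_def)
    ultimately have "(\<integral>y. unit_clamp y ^ k \<partial>m) = (\<integral>x. x ^ k \<partial>\<mu>)"
      by (rule LIMSEQ_unique)
    moreover have "(\<integral>x. x ^ k \<partial>distr m unit_borel unit_clamp) = (\<integral>y. unit_clamp y ^ k \<partial>m)"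
      by (rule integral_distr[OF cm measurable_on_unit(2)]) (auto intro!: continuous_intros)
    ultimately show "(\<integral>x. x ^ k \<partial>distr m unit_borel unit_clamp) = (\<integral>x. x ^ k \<partial>\<mu>)"
      by simp
  qed (rule \<mu>)
  show thesis
    by (rule that[OF m shift proj])
qed

subsection \<open>Shift-invariant measures on the orbit space\<close>

lemma orbit_shift_apply: "orbit_shift y i = y (Suc i)"
  by (simp add: orbit_shift_def)

text \<open>Euclid's algorithm as infinite descent: if y_0 = p/d, then y_1 = (d - a p)/p has the
  smaller denominator p. Here p = d is excluded, since y_0 = 1 forces y_1 = 0.\<close>

lemma orbit_irrational:
  assumes "y \<in> orbit_space" "\<And>i. y i \<noteq> 0"
  shows "y i \<notin> \<rat>"
proof -
  have no_frac: False if "y \<in> orbit_space" "\<And>i. y i \<noteq> 0" "y 0 * real d = real p" "0 < d"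
    for d p :: nat and y :: "nat \<Rightarrow> real"
    using that
  proof (induction d arbitrary: p y rule: less_induct)
    case (less d)
    obtain a where a: "1 \<le> a" "y 0 * (real a + y (Suc 0)) = 1" "0 < y 0" "y 0 \<le> 1" "y (Suc 0) \<in> {0..1}"
      using orbit_spaceD(1)[OF less.prems(1), of 0] less.prems(2) by (auto elim: gauss_rel_cases)
    have p0: "0 < p"
      using less.prems(3,4) a(3) by (metis mult_pos_pos of_nat_0_less_iff)
    have "y 0 * real d \<le> 1 * real d"
      using a(4) by (intro mult_right_mono) auto
    then have "p \<le> d" using less.prems(3) by simp
    moreover have "p \<noteq> d"
    proof
      assume "p = d"
      then have "y 0 = 1" using less.prems(3,4) by simp
      then have "y (Suc 0) = 1 - real a" using a(2) by simp
      then have "y (Suc 0) = 0" using a(1,5) by auto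
      then show False using less.prems(2) by blast
    qed
    ultimately have "p < d" by simp
    have "real p * (real a + y (Suc 0)) = real d * (y 0 * (real a + y (Suc 0)))"
      by (simp add: less.prems(3)[symmetric] algebra_simps)
    also have "\<dots> = real d"
      by (simp only: a(2) mult_1_right)
    finally have e: "y (Suc 0) * real p = real d - real (a * p)"
      by (simp add: algebra_simps)
    moreover have "0 \<le> y (Suc 0) * real p" using a(5) by simp
    ultimately have "real (a * p) \<le> real d" by linarith
    then have "orbit_shift y 0 * real p = real (d - a * p)"
      using e by (simp add: orbit_shift_def of_nat_diff del: of_nat_mult)
    then show False
      using less.IH[OF \<open>p < d\<close> orbit_shift_in_orbit_space[OF less.prems(1)]] less.prems(2) p0
      by (simp add: orbit_shift_def)
  qed
  define z where "z = (\<lambda>k. y (i + k))"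
  have z: "z \<in> orbit_space" "\<And>k. z k \<noteq> 0"
    using assms by (auto simp: z_def orbit_space_def)
  show ?thesis
  proof
    assume "y i \<in> \<rat>"
    then obtain p d :: nat where "d \<noteq> 0" "\<bar>y i\<bar> = real p / real d"
      by (rule Rats_abs_nat_div_natE)
    then have "z 0 * real d = real p"
      using orbit_spaceD(2)[OF assms(1), of i] by (simp add: z_def)
    then show False
      using no_frac[OF z] \<open>d \<noteq> 0\<close> by blast
  qed
qed

section \<open>Sequences without zeros, and words read off before a zero\<close>

definition never_zero :: "(nat \<Rightarrow> real) set" where
  "never_zero = {y \<in> orbit_space. \<forall>i. y i \<noteq> 0}"

definition first_zero :: "nat \<Rightarrow> (nat \<Rightarrow> real) set" where
  "first_zero n = {y \<in> orbit_space. y n = 0 \<and> (\<forall>i<n. y i \<noteq> 0)}"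

text \<open>The successor is irrational, hence not 1, so its digit is the one that
  \<open>gauss_map\<close> reads: along such sequences the relation is single-valued.\<close>

lemma never_zero_gauss:
  assumes "y \<in> never_zero"
  shows "gauss_map (y 0) = y (Suc 0)" "y 0 \<notin> \<rat>"
proof -
  have y: "y \<in> orbit_space" "\<And>i. y i \<noteq> 0"
    using assms by (auto simp: never_zero_def)
  show "y 0 \<notin> \<rat>" using orbit_irrational[OF y] .
  obtain a where a: "1 \<le> a" "y 0 * (real a + y (Suc 0)) = 1" "0 < y 0" "y (Suc 0) \<in> {0..1}"
    using orbit_spaceD(1)[OF y(1), of 0] y(2) by (auto elim: gauss_rel_cases)
  have "y (Suc 0) \<noteq> 1"
    using orbit_irrational[OF y, of "Suc 0"] by auto
  then have "gauss_map (1 / (real a + y (Suc 0))) = y (Suc 0)"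
    using a by (intro gauss_map_inverse_digit) auto
  moreover have "1 / (real a + y (Suc 0)) = y 0"
    using a by (simp add: field_simps)
  ultimately show "gauss_map (y 0) = y (Suc 0)" by simp
qed

abbreviation valid_digits :: "nat list \<Rightarrow> bool" where
  "valid_digits w \<equiv> \<forall>a\<in>set w. 1 \<le> a"

text \<open>The bound includes the empty suffix, of value 0, so the sequence must be 0 at index
  \<open>length w\<close>.\<close>

definition traces :: "(nat \<Rightarrow> real) \<Rightarrow> nat list \<Rightarrow> bool" where
  "traces y w \<longleftrightarrow> (\<forall>i\<le>length w. y i = cont_frac (drop i w))"

lemma traces_Cons: "traces y (a # w) \<longleftrightarrow> y 0 = 1 / (real a + y (Suc 0)) \<and> traces (orbit_shift y) w"
proof -
  have "traces y (a # w) \<longleftrightarrow> y 0 = 1 / (real a + cont_frac w) \<and> traces (orbit_shift y) w"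
    by (auto simp: traces_def orbit_shift_def less_Suc_eq_le[symmetric] less_Suc_eq_0_disj all_conj_distrib)
  moreover have "traces (orbit_shift y) w \<Longrightarrow> y (Suc 0) = cont_frac w"
    by (auto simp: traces_def orbit_shift_def)
  ultimately show ?thesis by auto
qed

lemma first_zero_Suc_shift:
  "y \<in> first_zero (Suc n) \<longleftrightarrow> y \<in> orbit_space \<and> y 0 \<noteq> 0 \<and> orbit_shift y \<in> first_zero n"
  using orbit_shift_in_orbit_space[of y]
  by (auto simp: first_zero_def orbit_shift_def less_Suc_eq_0_disj)

lemma first_zero_traces:
  assumes "y \<in> first_zero n"
  shows "\<exists>w. length w = n \<and> valid_digits w \<and> traces y w"
  using assms
proof (induction n arbitrary: y)
  case 0
  then show ?case by (simp add: first_zero_def traces_def)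
next
  case (Suc n)
  then have y: "y \<in> orbit_space" "y 0 \<noteq> 0" "orbit_shift y \<in> first_zero n"
    by (auto simp: first_zero_Suc_shift)
  obtain w where w: "length w = n" "valid_digits w" "traces (orbit_shift y) w"
    using Suc.IH[OF y(3)] by blast
  obtain a :: nat where a: "1 \<le> a" "y 0 * (real a + y (Suc 0)) = 1"
    using orbit_spaceD(1)[OF y(1), of 0] y(2) by (auto elim: gauss_rel_cases)
  from a(2) have "real a + y (Suc 0) \<noteq> 0" by auto
  with a(2) have "y 0 = 1 / (real a + y (Suc 0))"
    by (simp add: eq_divide_eq)
  then show ?case
    using w a by (intro exI[of _ "a # w"]) (simp add: traces_Cons)
qed

lemma traces_first_zero:
  assumes "y \<in> orbit_space" "valid_digits w" "traces y w"
  shows "y \<in> first_zero (length w)"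
  using assms
proof (induction w arbitrary: y)
  case Nil
  then show ?case by (simp add: first_zero_def traces_def)
next
  case (Cons a w)
  have "orbit_shift y \<in> first_zero (length w)"
    using Cons orbit_shift_in_orbit_space by (auto simp: traces_Cons)
  moreover have "y 0 \<noteq> 0"
    using Cons.prems orbit_spaceD(2)[OF Cons.prems(1), of "Suc 0"] by (auto simp: traces_Cons)
  ultimately show ?case
    using Cons.prems(1) by (simp add: first_zero_Suc_shift)
qed

lemma first_zero_unique: "y \<in> first_zero n \<Longrightarrow> y \<in> first_zero k \<Longrightarrow> n = k"
  unfolding first_zero_def by (cases n k rule: linorder_cases) auto

text \<open>A rational number can have two expansions, ending in a + 1 or in a, 1. They belong to
  different sequences: the next coordinate is recorded too and fixes the digit. The lengths agree,
  both being the time of the first zero.\<close>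

lemma traces_unique:
  assumes "y \<in> orbit_space" "valid_digits w" "traces y w" "valid_digits v" "traces y v"
  shows "w = v"
proof -
  have "length w = length v"
    using traces_first_zero[OF assms(1-3)] traces_first_zero[OF assms(1,4,5)] first_zero_unique by blast
  then show ?thesis
    using assms
  proof (induction w v arbitrary: y rule: list_induct2)
    case (Cons a w b v)
    have "1 / (real a + y (Suc 0)) = 1 / (real b + y (Suc 0))"
      using Cons.prems by (auto simp: traces_Cons)
    moreover have "0 < real a + y (Suc 0)" "0 < real b + y (Suc 0)"
      using Cons.prems orbit_spaceD(2)[OF Cons.prems(1), of "Suc 0"] by auto
    ultimately have "a = b" by simp
    moreover have "w = v"
      using Cons.prems orbit_shift_in_orbit_space by (intro Cons.IH[of "orbit_shift y"]) (auto simp: traces_Cons)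
    ultimately show ?case by simp
  qed simp
qed

section \<open>Borel measurability of the events\<close>

lemma coordinate_measurable: "(\<lambda>y :: nat \<Rightarrow> real. y i) \<in> borel_measurable borel"
  by (rule borel_measurable_continuous_onI) simp

lemma orbit_shift_measurable: "orbit_shift \<in> borel_measurable borel"
  by (rule borel_measurable_continuous_onI[OF continuous_on_orbit_shift])

lemma orbit_space_borel: "orbit_space \<in> sets borel"
  using closed_orbit_space by simp

lemma coordinate_sets: "A \<in> sets borel \<Longrightarrow> {y :: nat \<Rightarrow> real. y i \<in> A} \<in> sets borel"
  using measurable_sets[OF coordinate_measurable, of A i] by (simp add: vimage_def)

lemma zero_sets: "{y :: nat \<Rightarrow> real. y i = c} \<in> sets borel" "{y :: nat \<Rightarrow> real. y i \<noteq> c} \<in> sets borel"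
  using coordinate_sets[of "{c}" i] coordinate_sets[of "- {c}" i] by (simp_all add: Collect_neg_eq)

lemma first_zero_borel: "first_zero n \<in> sets borel"
proof -
  have "first_zero n = orbit_space \<inter> {y. y n = 0} \<inter> (\<Inter>i\<in>{..<n}. {y. y i \<noteq> 0})"
    by (auto simp: first_zero_def)
  moreover have "(\<Inter>i\<in>{..<n}. {y :: nat \<Rightarrow> real. y i \<noteq> 0}) \<in> sets borel"
    by (cases "n = 0") (auto intro!: sets.finite_INT zero_sets)
  ultimately show ?thesis
    by (simp add: sets.Int orbit_space_borel zero_sets)
qed

lemma never_zero_borel: "never_zero \<in> sets borel"
proof -
  have eq: "never_zero = orbit_space \<inter> (\<Inter>i. {y. y i \<noteq> 0})"
    by (auto simp: never_zero_def)
  show ?thesis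
    unfolding eq by (intro sets.Int orbit_space_borel sets.countable_INT'' zero_sets) simp_all
qed

lemma vimage_shift_borel: "A \<in> sets borel \<Longrightarrow> orbit_shift -` A \<in> sets borel"
  using measurable_sets[OF orbit_shift_measurable, of A] by simp

lemma traces_borel: "{y. traces y w} \<in> sets borel"
proof -
  have "{y. traces y w} = (\<Inter>i\<in>{..length w}. {y. y i = cont_frac (drop i w)})"
    by (auto simp: traces_def)
  also have "\<dots> \<in> sets borel"
    by (intro sets.finite_INT zero_sets) auto
  finally show ?thesis .
qed

text \<open>One excursion: zeros at times 0 and \<open>length w + 1\<close>, with \<open>w\<close>
  read in between; the empty word means two consecutive zeros. Invalid words get the empty set, so
  that sums may run over all lists.\<close>

definition enclosed :: "nat list \<Rightarrow> (nat \<Rightarrow> real) set" where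
  "enclosed w = {y \<in> orbit_space. y 0 = 0 \<and> valid_digits w \<and> traces (orbit_shift y) w}"

lemma enclosed_borel: "enclosed w \<in> sets borel"
proof (cases "valid_digits w")
  case True
  then have eq: "enclosed w = orbit_space \<inter> {y. y 0 = 0} \<inter> orbit_shift -` {y. traces y w}"
    unfolding enclosed_def by auto
  show ?thesis
    unfolding eq by (intro sets.Int orbit_space_borel zero_sets vimage_shift_borel traces_borel)
next
  case False
  then have "enclosed w = {}" unfolding enclosed_def by blast
  then show ?thesis by simp
qed

section \<open>Mass of excursions under a shift-invariant measure\<close>

locale shift_invariant_measure = prob_space m for m :: "(nat \<Rightarrow> real) measure" +
  assumes sets_m: "sets m = sets borel"
    and AE_orbit: "AE y in m. y \<in> orbit_space"
    and shift_invariant: "distr m borel orbit_shift = m"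
begin

lemma space_m: "space m = UNIV"
  using sets_eq_imp_space_eq[OF sets_m] by simp

lemma measure_shift:
  assumes "A \<in> sets borel"
  shows "emeasure m (orbit_shift -` A) = emeasure m A"
proof -
  have "orbit_shift \<in> measurable m borel"
    using orbit_shift_measurable by (simp add: measurable_cong_sets[OF sets_m refl])
  then have "emeasure (distr m borel orbit_shift) A = emeasure m (orbit_shift -` A)"
    using assms by (simp add: emeasure_distr space_m)
  then show ?thesis by (simp add: shift_invariant)
qed

lemma measure_orbit_cong:
  assumes "A \<in> sets borel" "B \<in> sets borel" "A \<inter> orbit_space = B \<inter> orbit_space"
  shows "emeasure m A = emeasure m B"
  by (rule emeasure_eq_AE) (use assms AE_orbit in \<open>auto simp: sets_m elim!: eventually_mono\<close>)

text \<open>\<open>L\<close> is the time at which \<open>B\<close> is tested and \<open>j\<close>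
  the time left from there to the next zero, which is also the index of the FCF point seen. The
  \<open>L\<close> coordinates before the test are nonzero.\<close>

definition visits :: "nat \<Rightarrow> nat \<Rightarrow> real set \<Rightarrow> (nat \<Rightarrow> real) set" where
  "visits j L B = {y \<in> first_zero (j + L). y L \<in> B}"

lemma visits_borel: "B \<in> sets borel \<Longrightarrow> visits j L B \<in> sets borel"
  using sets.Int[OF first_zero_borel coordinate_sets, of B "j + L" L]
  by (simp add: visits_def Int_def)

definition returns :: "nat \<Rightarrow> nat \<Rightarrow> real set \<Rightarrow> (nat \<Rightarrow> real) set" where
  "returns j L B = {y \<in> orbit_space. y 0 = 0 \<and> orbit_shift y \<in> visits j L B}"

lemma returns_borel:
  assumes "B \<in> sets borel"
  shows "returns j L B \<in> sets borel"
proof -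
  have "returns j L B = orbit_space \<inter> {y. y 0 = 0} \<inter> orbit_shift -` visits j L B"
    by (auto simp: returns_def)
  then show ?thesis
    using assms by (auto intro!: sets.Int orbit_space_borel zero_sets vimage_shift_borel visits_borel)
qed

text \<open>Invariance allows a look one step into the past: the preceding coordinate is either
  zero, which closes the excursion on the left, or nonzero, which lengthens its known part by
  one.\<close>

lemma visits_split:
  assumes B: "B \<in> sets borel"
  shows "emeasure m (visits j L B) = emeasure m (returns j L B) + emeasure m (visits j (Suc L) B)"
proof -
  have "emeasure m (visits j L B) = emeasure m (orbit_shift -` visits j L B)"
    by (rule measure_shift[symmetric]) (rule visits_borel[OF B])
  also have "\<dots> = emeasure m (returns j L B \<union> visits j (Suc L) B)"
  proof (rule measure_orbit_cong)
    show "orbit_shift -` visits j L B \<in> sets borel"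
      by (intro vimage_shift_borel visits_borel B)
    show "returns j L B \<union> visits j (Suc L) B \<in> sets borel"
      by (intro sets.Un returns_borel visits_borel B)
    show "orbit_shift -` visits j L B \<inter> orbit_space = (returns j L B \<union> visits j (Suc L) B) \<inter> orbit_space"
      by (auto simp: returns_def visits_def first_zero_Suc_shift orbit_shift_apply)
  qed
  also have "\<dots> = emeasure m (returns j L B) + emeasure m (visits j (Suc L) B)"
  proof (rule plus_emeasure[symmetric])
    show "returns j L B \<in> sets m" "visits j (Suc L) B \<in> sets m"
      by (simp_all only: sets_m returns_borel visits_borel B)
    show "returns j L B \<inter> visits j (Suc L) B = {}"
      by (auto simp: returns_def visits_def first_zero_Suc_shift)
  qed
  finally show ?thesis .
qed

text \<open>Poincare recurrence: the sets \<open>visits j L B\<close> are pairwise disjoint for varying \<open>L\<close>, so the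
  remainder of the telescoping sum tends to 0.\<close>

lemma visits_sums_returns:
  assumes B: "B \<in> sets borel"
  shows "emeasure m (visits j 0 B) = (\<Sum>L. emeasure m (returns j L B))"
proof -
  have split: "measure m (returns j L B) = measure m (visits j L B) - measure m (visits j (Suc L) B)" for L
    using visits_split[OF B, of j L] by (simp add: emeasure_eq_measure flip: ennreal_plus)
  have "disjoint_family (\<lambda>L. visits j L B)"
    unfolding disjoint_family_on_def visits_def using first_zero_unique by fastforce
  then have "(\<lambda>L. measure m (visits j L B)) sums measure m (\<Union>L. visits j L B)"
    using visits_borel[OF B] by (intro finite_measure_UNION) (auto simp: sets_m)
  then have "(\<lambda>L. measure m (visits j L B)) \<longlonglongrightarrow> 0"
    by (simp add: sums_iff summable_LIMSEQ_zero)
  then have "(\<lambda>L. measure m (returns j L B)) sums (measure m (visits j 0 B) - 0)"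
    unfolding split by (rule telescope_sums')
  then have "(\<Sum>L. ennreal (measure m (returns j L B))) = ennreal (measure m (visits j 0 B))"
    by (intro suminf_ennreal_eq) auto
  then show ?thesis
    by (simp add: emeasure_eq_measure)
qed

definition return_mass :: "nat list \<Rightarrow> ennreal" where
  "return_mass w = emeasure m (enclosed w)"

lemma return_mass_invalid: "\<not> valid_digits w \<Longrightarrow> return_mass w = 0"
proof -
  assume "\<not> valid_digits w"
  then have "enclosed w = {}" unfolding enclosed_def by blast
  then show ?thesis by (simp add: return_mass_def)
qed

text \<open>Excursions are sorted by their word, countably many and disjoint by
  \<open>traces_unique\<close>; the coordinate tested is the value of the word without its
  \<open>L\<close> leading digits.\<close>

lemma emeasure_returns:
  assumes B: "B \<in> sets borel"
  shows "emeasure m (returns j L B) =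
    (\<integral>\<^sup>+w. return_mass w * of_bool (length w = j + L \<and> cont_frac (drop L w) \<in> B) \<partial>count_space UNIV)"
proof -
  define I where "I = {w :: nat list. length w = j + L \<and> cont_frac (drop L w) \<in> B}"
  have "returns j L B = (\<Union>w\<in>I. enclosed w)"
  proof (intro set_eqI iffI)
    fix y assume y: "y \<in> returns j L B"
    then obtain w where w: "length w = j + L" "valid_digits w" "traces (orbit_shift y) w"
      using first_zero_traces[of "orbit_shift y" "j + L"] by (auto simp: returns_def visits_def)
    then have "w \<in> I"
      using y by (auto simp: I_def returns_def visits_def traces_def)
    then show "y \<in> (\<Union>w\<in>I. enclosed w)"
      using y w by (auto simp: enclosed_def returns_def)
  next
    fix y assume "y \<in> (\<Union>w\<in>I. enclosed w)"
    then obtain w where w: "w \<in> I" "y \<in> enclosed w" by auto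
    then show "y \<in> returns j L B"
      using traces_first_zero[of "orbit_shift y" w] orbit_shift_in_orbit_space[of y]
      by (auto simp: returns_def visits_def enclosed_def I_def) (auto simp: traces_def)
  qed
  then have "emeasure m (returns j L B) = emeasure m (\<Union>w\<in>I. enclosed w)" by simp
  also have "\<dots> = (\<integral>\<^sup>+w. return_mass w \<partial>count_space I)"
    unfolding return_mass_def
  proof (rule emeasure_UN_countable)
    show "disjoint_family_on enclosed I"
      unfolding disjoint_family_on_def
    proof (intro ballI impI)
      fix v w :: "nat list" assume "v \<noteq> w"
      have False if "y \<in> enclosed v" "y \<in> enclosed w" for y
        using traces_unique[of "orbit_shift y" v w] orbit_shift_in_orbit_space[of y] that \<open>v \<noteq> w\<close>
        unfolding enclosed_def by blast
      then show "enclosed v \<inter> enclosed w = {}" by blast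
    qed
  qed (auto simp: sets_m enclosed_borel)
  also have "\<dots> = (\<integral>\<^sup>+w. return_mass w * indicator I w \<partial>count_space UNIV)"
    by (rule nn_integral_count_space_indicator) simp
  finally show ?thesis
    by (simp add: I_def indicator_def)
qed

text \<open>For each \<open>j \<le> length w\<close> only \<open>L = length w - j\<close>
  contributes, with the point \<open>fcf_point w j\<close>. The factor \<open>length w + 1\<close>,
  which undoes the averaging, is the return time to zero.\<close>

lemma fcf_count:
  assumes "valid_digits w" "B \<in> sets unit_borel"
  shows "(\<Sum>j. \<Sum>L. of_bool (length w = j + L \<and> cont_frac (drop L w) \<in> B)) =
    of_nat (length w + 1) * emeasure (fcf_measure w) B"
proof -
  have inner: "(\<Sum>L. of_bool (length w = j + L \<and> cont_frac (drop L w) \<in> B) :: ennreal) =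
      (if j \<le> length w then indicator B (fcf_point w j) else 0)" for j
  proof (cases "j \<le> length w")
    case True
    have "(\<Sum>L. of_bool (length w = j + L \<and> cont_frac (drop L w) \<in> B) :: ennreal) =
        (\<Sum>L\<in>{length w - j}. of_bool (length w = j + L \<and> cont_frac (drop L w) \<in> B))"
      by (rule suminf_finite) auto
    then show ?thesis
      using True by (simp add: fcf_point_def indicator_def)
  qed auto
  have "(\<Sum>j. \<Sum>L. of_bool (length w = j + L \<and> cont_frac (drop L w) \<in> B) :: ennreal) =
      (\<Sum>j\<le>length w. indicator B (fcf_point w j))"
    unfolding inner by (subst suminf_finite[of "{..length w}"]) auto
  also have "\<dots> = ennreal (real (length w + 1)) *
      ((\<Sum>j\<le>length w. indicator B (fcf_point w j)) / ennreal (real (length w + 1)))"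
    by (subst ennreal_times_divide, subst mult.commute, subst ennreal_mult_divide_eq) auto
  also have "\<dots> = of_nat (length w + 1) * emeasure (fcf_measure w) B"
    using fcf_point_in_unit[OF assms(1)]
    by (simp add: fcf_measure_eq_uniform_points[OF assms(1)] emeasure_uniform_points[OF _ assms(2)]
        ennreal_of_nat_eq_real_of_nat)
  finally show ?thesis .
qed

text \<open>Kac's formula: sequences are split by the time j of their first zero, recurrence sums
  over the possible pasts, and Tonelli brings the word outermost. What a word collects is its return
  time times its FCF measure.\<close>

lemma rational_part:
  assumes B: "B \<in> sets unit_borel"
  shows "emeasure m {y \<in> orbit_space. y 0 \<in> B \<and> y \<notin> never_zero} =
    (\<integral>\<^sup>+w. return_mass w * of_nat (length w + 1) * emeasure (fcf_measure w) B \<partial>count_space UNIV)"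
proof -
  have Bb: "B \<in> sets borel"
    using B by (simp add: sets_restrict_space_iff)
  have "{y \<in> orbit_space. y 0 \<in> B \<and> y \<notin> never_zero} = (\<Union>j. visits j 0 B)"
  proof (intro set_eqI iffI)
    fix y assume y: "y \<in> {y \<in> orbit_space. y 0 \<in> B \<and> y \<notin> never_zero}"
    then obtain i where "y i = 0" by (auto simp: never_zero_def)
    then obtain j where j: "y j = 0" "\<forall>k<j. y k \<noteq> 0"
      using exists_least_iff[of "\<lambda>i. y i = 0"] by blast
    then have "y \<in> visits j 0 B"
      using y by (simp add: visits_def first_zero_def)
    then show "y \<in> (\<Union>j. visits j 0 B)" by blast
  next
    fix y assume "y \<in> (\<Union>j. visits j 0 B)"
    then obtain j where "y \<in> visits j 0 B" by blast
    then have "y \<in> orbit_space" "y 0 \<in> B" "y j = 0"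
      by (simp_all add: visits_def first_zero_def)
    then show "y \<in> {y \<in> orbit_space. y 0 \<in> B \<and> y \<notin> never_zero}"
      unfolding never_zero_def by blast
  qed
  also have "emeasure m \<dots> = (\<Sum>j. emeasure m (visits j 0 B))"
  proof (rule suminf_emeasure[symmetric])
    show "range (\<lambda>j. visits j 0 B) \<subseteq> sets m"
      using visits_borel[OF Bb] by (auto simp: sets_m)
    show "disjoint_family (\<lambda>j. visits j 0 B)"
      unfolding disjoint_family_on_def visits_def using first_zero_unique by fastforce
  qed
  also have "\<dots> = (\<Sum>j. \<Sum>L. \<integral>\<^sup>+w. return_mass w * of_bool (length w = j + L \<and> cont_frac (drop L w) \<in> B) \<partial>count_space UNIV)"
    by (simp only: visits_sums_returns[OF Bb] emeasure_returns[OF Bb])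
  also have "\<dots> = (\<integral>\<^sup>+w. (\<Sum>j. \<Sum>L. return_mass w * of_bool (length w = j + L \<and> cont_frac (drop L w) \<in> B)) \<partial>count_space UNIV)"
    by (simp only: nn_integral_suminf[OF borel_measurable_count_space])
  also have "\<dots> = (\<integral>\<^sup>+w. return_mass w * of_nat (length w + 1) * emeasure (fcf_measure w) B \<partial>count_space UNIV)"
  proof (rule nn_integral_cong)
    fix w :: "nat list"
    have "(\<Sum>j. \<Sum>L. return_mass w * of_bool (length w = j + L \<and> cont_frac (drop L w) \<in> B)) =
        return_mass w * (\<Sum>j. \<Sum>L. of_bool (length w = j + L \<and> cont_frac (drop L w) \<in> B))"
      by (simp only: ennreal_suminf_cmult)
    then show "(\<Sum>j. \<Sum>L. return_mass w * of_bool (length w = j + L \<and> cont_frac (drop L w) \<in> B)) =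
        return_mass w * of_nat (length w + 1) * emeasure (fcf_measure w) B"
      using fcf_count[OF _ B, of w] return_mass_invalid[of w] by (cases "valid_digits w") (simp_all add: mult.assoc)
  qed
  finally show ?thesis .
qed

text \<open>\<open>never_zero\<close> lies in its preimage under the shift and both have the same
  finite measure, so they differ by a null set. There the shift acts on coordinate 0 as
  \<open>gauss_map\<close>.\<close>

lemma never_zero_invariant:
  assumes B: "B \<in> sets unit_borel"
  shows "emeasure m (never_zero \<inter> {y. y 0 \<in> gauss_map -` B \<inter> {0..1}}) = emeasure m (never_zero \<inter> {y. y 0 \<in> B})"
proof -
  have Bb: "B \<in> sets borel" and GB: "gauss_map -` B \<inter> {0..1} \<in> sets borel"
    using B gauss_vimage_sets[OF B] by (simp_all add: sets_restrict_space_iff)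
  define A where "A = never_zero \<inter> {y. y 0 \<in> B}"
  have A: "A \<in> sets borel"
    unfolding A_def by (intro sets.Int never_zero_borel coordinate_sets Bb)
  have sub: "never_zero \<subseteq> orbit_shift -` never_zero"
    by (auto simp: never_zero_def orbit_shift_in_orbit_space) (auto simp: orbit_shift_def)
  have "emeasure m (orbit_shift -` never_zero - never_zero) = emeasure m never_zero - emeasure m never_zero"
    using sub by (subst emeasure_Diff)
      (auto simp: sets_m never_zero_borel vimage_shift_borel measure_shift)
  then have null: "emeasure m (orbit_shift -` never_zero - never_zero) = 0"
    by (simp add: emeasure_eq_measure)
  have eq: "never_zero \<inter> {y. y 0 \<in> gauss_map -` B \<inter> {0..1}} = never_zero \<inter> orbit_shift -` A"
    using sub never_zero_gauss(1) orbit_spaceD(2)[of _ 0]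
    by (auto simp: A_def orbit_shift_def never_zero_def)
  have "emeasure m A = emeasure m (orbit_shift -` A)"
    by (rule measure_shift[OF A, symmetric])
  also have "\<dots> = emeasure m (never_zero \<inter> orbit_shift -` A)"
  proof (rule emeasure_eq_AE)
    have "AE y in m. y \<notin> orbit_shift -` never_zero - never_zero"
      by (rule AE_not_in) (use null in \<open>auto simp: null_sets_def sets_m never_zero_borel vimage_shift_borel\<close>)
    then show "AE y in m. y \<in> orbit_shift -` A \<longleftrightarrow> y \<in> never_zero \<inter> orbit_shift -` A"
      by eventually_elim (auto simp: A_def)
  qed (auto simp: sets_m A never_zero_borel vimage_shift_borel)
  finally show ?thesis
    unfolding eq A_def[symmetric] by (rule sym)
qed

end

subsection \<open>Decomposition of the projection\<close>

context shift_invariant_measure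
begin

lemma unit_clamp_measurable_m: "unit_clamp \<in> measurable m unit_borel"
  using unit_clamp_measurable by (simp add: measurable_cong_sets[OF sets_m refl])

lemma unit_clamp_vimage_borel: "A \<in> sets unit_borel \<Longrightarrow> unit_clamp -` A \<in> sets borel"
  using measurable_sets[OF unit_clamp_measurable, of A] by simp

lemma unit_clamp_vimage_inter:
  assumes "S \<subseteq> orbit_space"
  shows "S \<inter> unit_clamp -` A = S \<inter> {y. y 0 \<in> A}"
  using assms unit_clamp_eq orbit_spaceD(2)[of _ 0] by auto

lemma never_zero_subset: "never_zero \<subseteq> orbit_space"
  by (auto simp: never_zero_def)

lemma projection_decomposition:
  assumes A: "A \<in> sets unit_borel"
  shows "emeasure (distr m unit_borel unit_clamp) A = emeasure m (never_zero \<inter> {y. y 0 \<in> A}) +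
    (\<integral>\<^sup>+w. return_mass w * of_nat (length w + 1) * emeasure (fcf_measure w) A \<partial>count_space UNIV)"
proof -
  have Ab: "A \<in> sets borel"
    using A by (simp add: sets_restrict_space_iff)
  define R where "R = {y \<in> orbit_space. y 0 \<in> A \<and> y \<notin> never_zero}"
  have Req: "R = orbit_space \<inter> {y. y 0 \<in> A} \<inter> (- never_zero)"
    by (auto simp: R_def)
  have R: "R \<in> sets borel"
    unfolding Req by (intro sets.Int orbit_space_borel coordinate_sets Ab borel_comp never_zero_borel)
  have N: "never_zero \<inter> {y. y 0 \<in> A} \<in> sets borel"
    by (intro sets.Int never_zero_borel coordinate_sets Ab)
  have "emeasure (distr m unit_borel unit_clamp) A = emeasure m (unit_clamp -` A)"
    by (simp add: emeasure_distr[OF unit_clamp_measurable_m A] space_m)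
  also have "\<dots> = emeasure m ((never_zero \<inter> {y. y 0 \<in> A}) \<union> R)"
  proof (rule measure_orbit_cong)
    show "unit_clamp -` A \<inter> orbit_space = (never_zero \<inter> {y. y 0 \<in> A} \<union> R) \<inter> orbit_space"
      using unit_clamp_vimage_inter[of orbit_space A] by (auto simp: R_def)
  qed (intro unit_clamp_vimage_borel A sets.Un N R)+
  also have "\<dots> = emeasure m (never_zero \<inter> {y. y 0 \<in> A}) + emeasure m R"
  proof (rule plus_emeasure[symmetric])
    show "never_zero \<inter> {y. y 0 \<in> A} \<in> sets m" "R \<in> sets m"
      using N R by (simp_all only: sets_m)
  qed (auto simp: R_def)
  finally show ?thesis
    by (simp only: R_def rational_part[OF A])
qed

text \<open>The law of coordinate 0 conditioned on \<open>never_zero\<close>; a probability measure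
  only if that event has positive mass, hence the case c = 0 in
  \<open>projection_in_hull\<close>.\<close>

definition irrational_part :: "real measure" where
  "irrational_part = distr (uniform_measure m never_zero) unit_borel unit_clamp"

lemma emeasure_irrational_part:
  assumes A: "A \<in> sets unit_borel"
  shows "emeasure irrational_part A = emeasure m (never_zero \<inter> {y. y 0 \<in> A}) / emeasure m never_zero"
proof -
  have "unit_clamp \<in> measurable (uniform_measure m never_zero) unit_borel"
    using unit_clamp_measurable_m by (simp add: measurable_cong_sets[OF sets_uniform_measure refl])
  then have "emeasure irrational_part A = emeasure (uniform_measure m never_zero) (unit_clamp -` A)"
    using A by (simp add: irrational_part_def emeasure_distr space_m)
  also have "\<dots> = emeasure m (never_zero \<inter> unit_clamp -` A) / emeasure m never_zero"
    by (rule emeasure_uniform_measure) (simp_all only: sets_m never_zero_borel unit_clamp_vimage_borel[OF A])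
  finally show ?thesis
    by (simp only: unit_clamp_vimage_inter[OF never_zero_subset])
qed

lemma irrational_part_invariant:
  assumes ne: "emeasure m never_zero \<noteq> 0"
  shows "irrational_part \<in> irrational_invariant_measures"
proof -
  have "prob_space (uniform_measure m never_zero)"
    using ne by (intro prob_space_uniform_measure) auto
  moreover have "unit_clamp \<in> measurable (uniform_measure m never_zero) unit_borel"
    using unit_clamp_measurable_m by (simp add: measurable_cong_sets[OF sets_uniform_measure refl])
  ultimately have "prob_space irrational_part"
    unfolding irrational_part_def by (rule prob_space.prob_space_distr)
  then have p: "irrational_part \<in> prob_measures"
    by (simp add: prob_measures_def irrational_part_def)
  have "irrational_part \<in> invariant_measures"
    by (rule invariant_measuresI[OF p])
      (simp only: emeasure_irrational_part gauss_vimage_sets never_zero_invariant)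
  moreover have "(\<rat> :: real set) \<in> sets borel"
    by (rule sets.countable[OF _ countable_rat]) simp
  then have "{0..1} \<inter> \<rat> \<in> sets unit_borel"
    by (simp add: sets_restrict_space_iff)
  then have "emeasure irrational_part ({0..1} \<inter> \<rat>) =
      emeasure m (never_zero \<inter> {y. y 0 \<in> {0..1} \<inter> \<rat>}) / emeasure m never_zero"
    by (rule emeasure_irrational_part)
  moreover have "never_zero \<inter> {y. y 0 \<in> {0..1} \<inter> \<rat>} = {}"
    using never_zero_gauss(2) by blast
  ultimately show ?thesis
    by (simp add: irrational_invariant_measures_def)
qed

lemma projection_in_hull:
  "distr m unit_borel unit_clamp \<in>
    countable_convex_hull (irrational_invariant_measures \<union> fcf_measures)"
proof -
  define \<mu> where "\<mu> = distr m unit_borel unit_clamp"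
  define e :: "nat \<Rightarrow> nat list" where "e = from_nat_into UNIV"
  have e: "bij_betw e UNIV UNIV"
    unfolding e_def by (rule bij_betw_from_nat_into) (simp_all add: infinite_UNIV_listI)
  define c where "c = measure m never_zero"
  \<comment> \<open>Index 0 carries the part without zeros, index k + 1 the k-th word, weighted by
    excursion mass times return time.\<close>
  define w where "w i = (case i of 0 \<Rightarrow> c | Suc k \<Rightarrow> measure m (enclosed (e k)) * real (length (e k) + 1))" for i
  \<comment> \<open>Where the weight is 0, \<open>fcf_measure []\<close> is the default, since every
    term must be a member of the set.\<close>
  define \<nu> where "\<nu> i = (case i of 0 \<Rightarrow> if c = 0 then fcf_measure [] else irrational_part
    | Suc k \<Rightarrow> if valid_digits (e k) then fcf_measure (e k) else fcf_measure [])" for i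
  have \<mu>p: "\<mu> \<in> prob_measures"
    using prob_space_distr[OF unit_clamp_measurable_m] by (simp add: \<mu>_def prob_measures_def)
  have cem: "emeasure m never_zero = ennreal c"
    by (simp add: c_def emeasure_eq_measure)
  have \<nu>: "\<nu> i \<in> irrational_invariant_measures \<union> fcf_measures" for i
  proof -
    have "fcf_measure v \<in> fcf_measures" if "valid_digits v" for v
      using that unfolding fcf_measures_def by blast
    moreover have "irrational_part \<in> irrational_invariant_measures" if "c \<noteq> 0"
      using that irrational_part_invariant by (simp add: cem c_def)
    ultimately show ?thesis
      by (simp add: \<nu>_def split: nat.split)
  qed
  have w0: "0 \<le> w i" for i
    by (simp add: w_def c_def split: nat.split)
  have \<nu>p: "prob_space (\<nu> i)" for i
    using \<nu>[of i] fcf_measures_subset invariant_measures_subset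
    by (auto simp: irrational_invariant_measures_def prob_measures_def)
  have main: "(\<lambda>i. w i * measure (\<nu> i) A) sums measure \<mu> A" if A: "A \<in> sets unit_borel" for A
  proof -
    have \<nu>em: "emeasure (\<nu> i) A = ennreal (measure (\<nu> i) A)" for i
      by (rule finite_measure.emeasure_eq_measure[OF prob_space.finite_measure[OF \<nu>p]])
    have \<mu>em: "emeasure \<mu> A = ennreal (measure \<mu> A)"
      using \<mu>p by (simp add: prob_measures_def finite_measure.emeasure_eq_measure prob_space.finite_measure)
    have first: "emeasure m (never_zero \<inter> {y. y 0 \<in> A}) = ennreal (w 0 * measure (\<nu> 0) A)"
    proof (cases "c = 0")
      case True
      have "emeasure m (never_zero \<inter> {y. y 0 \<in> A}) \<le> emeasure m never_zero"
        by (rule emeasure_mono) (auto simp: sets_m never_zero_borel)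
      then show ?thesis
        using True by (simp add: cem w_def)
    next
      case False
      then have c: "0 < c" by (simp add: c_def less_le)
      have "emeasure m (never_zero \<inter> {y. y 0 \<in> A}) = ennreal c * emeasure (\<nu> 0) A"
        using False c by (simp add: \<nu>_def emeasure_irrational_part[OF A] cem ennreal_times_divide
            mult.commute[of "ennreal c"] ennreal_mult_divide_eq)
      also have "\<dots> = ennreal (w 0 * measure (\<nu> 0) A)"
        using c by (simp add: \<nu>em w_def ennreal_mult)
      finally show ?thesis .
    qed
    have rest: "return_mass (e k) * of_nat (length (e k) + 1) * emeasure (fcf_measure (e k)) A =
        ennreal (w (Suc k) * measure (\<nu> (Suc k)) A)" for k
    proof (cases "valid_digits (e k)")
      case True
      then have "\<nu> (Suc k) = fcf_measure (e k)" by (simp add: \<nu>_def)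
      then show ?thesis
        using \<nu>em[of "Suc k"]
        by (simp add: w_def return_mass_def emeasure_eq_measure ennreal_mult ennreal_of_nat_eq_real_of_nat del: of_nat_Suc)
    next
      case False
      then have "return_mass (e k) = 0" "measure m (enclosed (e k)) = 0"
        using return_mass_invalid[OF False] by (simp_all add: return_mass_def emeasure_eq_measure)
      then show ?thesis by (simp add: w_def)
    qed
    have "(\<integral>\<^sup>+w. return_mass w * of_nat (length w + 1) * emeasure (fcf_measure w) A \<partial>count_space UNIV) =
        (\<integral>\<^sup>+k. return_mass (e k) * of_nat (length (e k) + 1) * emeasure (fcf_measure (e k)) A \<partial>count_space UNIV)"
      by (rule nn_integral_bij_count_space[OF e, symmetric])
    also have "\<dots> = (\<Sum>k. ennreal (w (Suc k) * measure (\<nu> (Suc k)) A))"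
      by (simp only: nn_integral_count_space_nat rest)
    finally have dec: "ennreal (measure \<mu> A) = ennreal (w 0 * measure (\<nu> 0) A) +
        (\<Sum>k. ennreal (w (Suc k) * measure (\<nu> (Suc k)) A))"
      using projection_decomposition[OF A] by (simp only: \<mu>_def[symmetric] \<mu>em first)
    have nn: "0 \<le> w i * measure (\<nu> i) A" for i
      using w0 by simp
    \<comment> \<open>Finiteness, inherited from the mass of \<open>\<mu>\<close>, permits the
      passage from extended to real sums.\<close>
    have "(\<Sum>k. ennreal (w (Suc k) * measure (\<nu> (Suc k)) A)) \<noteq> top"
    proof
      assume "(\<Sum>k. ennreal (w (Suc k) * measure (\<nu> (Suc k)) A)) = top"
      then show False using dec by simp
    qed
    then have s: "summable (\<lambda>k. w (Suc k) * measure (\<nu> (Suc k)) A)"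
      using nn by (intro summable_suminf_not_top) auto
    define t where "t = (\<Sum>k. w (Suc k) * measure (\<nu> (Suc k)) A)"
    have t: "0 \<le> t" unfolding t_def by (rule suminf_nonneg[OF s]) (rule nn)
    have "(\<Sum>k. ennreal (w (Suc k) * measure (\<nu> (Suc k)) A)) = ennreal t"
      unfolding t_def using nn s by (intro suminf_ennreal2) auto
    then have "ennreal (measure \<mu> A) = ennreal (w 0 * measure (\<nu> 0) A + t)"
      using dec t nn[of 0] by (simp add: ennreal_plus)
    then have "measure \<mu> A = t + w 0 * measure (\<nu> 0) A"
      by (subst (asm) ennreal_inj) (use t nn[of 0] in auto)
    moreover have "(\<lambda>i. w i * measure (\<nu> i) A) sums (t + w 0 * measure (\<nu> 0) A)"
      using summable_sums[OF s] unfolding t_def by (rule sums_Suc)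
    ultimately show ?thesis by simp
  qed
  \<comment> \<open>The total weight is read off from the decomposition on the whole interval, where
    every measure has mass 1.\<close>
  have "w sums 1"
  proof -
    have one: "measure \<kappa> {0..1} = 1" if "prob_space \<kappa>" "space \<kappa> = {0..1}" for \<kappa> :: "real measure"
      using prob_space.prob_space[OF that(1)] that(2) by simp
    have "\<nu> i \<in> prob_measures" for i
      using \<nu>[of i] fcf_measures_subset invariant_measures_subset
      by (auto simp: irrational_invariant_measures_def)
    then have "measure (\<nu> i) {0..1} = 1" for i
      using one[OF \<nu>p] space_prob_measure by blast
    moreover have "measure \<mu> {0..1} = 1"
      using one \<mu>p space_prob_measure by (simp add: prob_measures_def)
    ultimately show ?thesis
      using main[of "{0..1}"] by (simp add: sets_restrict_space_iff)
  qed
  then have "\<mu> \<in> countable_convex_hull (irrational_invariant_measures \<union> fcf_measures)"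
    unfolding countable_convex_hull_def using \<mu>p w0 \<nu> main by blast
  then show ?thesis by (simp only: \<mu>_def)
qed

end

theorem theorem1:
  shows "weak_star_topology closure_of invariant_measures =
         countable_convex_hull (irrational_invariant_measures \<union> fcf_measures)"
proof (rule equalityI[OF subsetI hull_subset_closure])
  fix \<mu> assume "\<mu> \<in> weak_star_topology closure_of invariant_measures"
  then obtain m where m: "prob_space m" "sets m = sets borel" "AE y in m. y \<in> orbit_space"
    "distr m borel orbit_shift = m" and \<mu>: "distr m unit_borel unit_clamp = \<mu>"
    by (rule closure_lift)
  interpret shift_invariant_measure m
    using m by (intro shift_invariant_measure.intro shift_invariant_measure_axioms.intro)
  show "\<mu> \<in> countable_convex_hull (irrational_invariant_measures \<union> fcf_measures)"
    using projection_in_hull by (simp only: \<mu>)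
qed

end
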